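(* Consider a TIM-MP instance with $K$ users whose conflict digraph $\mathcal D$ contains no dicycle $C_n$ with $n\ge 3$ and whose clique-vertex incidence matrix $\boldsymbol A$ is a perfect matrix. Then the optimal DoF region, achieved by orthogonal access, is the set packing polytope $$\mathscr D=\Big\{(d_1,\dots,d_K): 0\le d_k\le 1\ \forall k\in\mathcal K,\ \ \sum_{k\in Q}d_k\le1\ \forall Q\in\mathcal Q(S(\mathcal D))\Big\},$$ where the undirected graph $S(\mathcal D)$ is the symmetric part of $\mathcal D$ and $\mathcal Q(S(\mathcal D))$ is the set of all maximal cliques of $S(\mathcal D)$.
   Context: TIM-MP (topological interference management with decoded message passing) model. Let $\mathcal K=\{1,\dots,K\}$. Transmitter (user) $i$ has a message $W_i$ for receiver (base station) $i$, $i\in\mathcal K$. The network topology $\mathcal G$, fixed throughout the communication, is given by sets $\mathcal T_j\subseteq\mathcal K$ with $j\in\mathcal T_j$ (the transmitters connected to receiver $j$). At time $t$ receiver $j$ observes $Y_j(t)=\sum_{i\in\mathcal T_j}h_{ji}(t)X_i(t)+Z_j(t)$, where $X_i(t)$ is the complex transmitted signal with average power constraint $\mathbb E|X_i|^2\le P$, $Z_j(t)$ is Gaussian noise with zero mean and unit variance, and $h_{ji}(t)$ is the channel coefficient between transmitter $i$ and receiver $j$. The channel coefficients are not known to the transmitters, which know only $\mathcal G$; the receivers know $\mathcal G$ and $\mathcal H=\{h_{ji}(t)\}$. A decoding order $\pi$ is a partial order $\prec_\pi$ on $\mathcal K$; $i\prec_\pi j$ means $W_i$ is decoded before $W_j$.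 A rate tuple $(R_1,\dots,R_K)$ is achievable under $\pi$ if there are length-$n$ codes with $W_i$ uniform on $[1:2^{nR_i}]$, encoders $X_i^n=f_i(W_i,\mathcal G)$, and decoders $\hat W_j=g_j(Y_j^n,\{\hat W_k:k\prec_\pi j\},\mathcal G,\mathcal H)$ (earlier decoded messages are passed to receiver $j$), such that the decoding error $\max_j\Pr(W_j\ne\hat W_j)$ tends to $0$ as $n\to\infty$. $\mathcal R^\pi$ is the set of rate tuples achievable under $\pi$ (single-round message passing); the capacity region is $\mathscr C=\mathrm{conv}(\bigcup_\pi\mathcal R^\pi)$ (multiple-round message passing). The DoF region $\mathscr D$ is the set of $(d_1,\dots,d_K)\in\mathbb R_+^K$ with $d_i=\limsup_{P\to\infty}R_i/\log P$ for all $i$, where $(R_1,\dots,R_K)\in\mathscr C$. Conflict digraph: $\mathcal D=(\mathcal K,\mathcal A)$ with $(i,j)\in\mathcal A$ iff $i\neq j$ and $i\in\mathcal T_j$. An acyclic set is a set of vertices inducing a sub-digraph without directed cycles. Orthogonal access schedules acyclic sets of $\mathcal D$ orthogonally across time or frequency (messages of one acyclic set are sent simultaneously and decoded successively via message passing); with time sharing it achieves the convex hull of the $0/1$ incidence vectors of acyclic sets. A dicycle $C_n$ is a set of $n$ vertices whose induced sub-digraph is exactly a directed cycle of length $n$ (no further arcs). The symmetric part $S(\mathcal D)$ is the undirected graph on the same vertices with edge $uv$ iff both $(u,v),(v,u)\in\mathcal A$. Cliques of $\mathcal D$ are vertex sets with both arcs between every two distinct members, i.e. cliques of $S(\mathcal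 D)$. $\boldsymbol A$ is the $0/1$ matrix whose rows are the incidence vectors of the maximal cliques of $\mathcal D$. A $0/1$ matrix $\boldsymbol M$ with $n$ columns is perfect if $\{x\in[0,1]^n:\boldsymbol Mx\le\mathbf 1\}$ has only integral extreme points.
   Formalization: The limsup of R_i/log P is taken jointly, along a common sequence of powers (coordinatewise, alternating rates would give (1,1) on a 2-clique); codes must work for every channel whose link coefficients have modulus between fixed positive bounds. *)

theory Defs
  imports "HOL-Probability.Probability"
begin

section \<open>Digraphs, cliques, perfect matrices\<close>

text \<open>The user set is a finite type \<open>'k\<close>; digraphs on it are arc sets. \<open>T j\<close> is the set of
  transmitters connected to receiver \<open>j\<close>.\<close>

definition conflict_digraph :: "('k \<Rightarrow> 'k set) \<Rightarrow> ('k \<times> 'k) set" where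
  "conflict_digraph T = {(i, j). i \<noteq> j \<and> i \<in> T j}"

definition induced :: "('k \<times> 'k) set \<Rightarrow> 'k set \<Rightarrow> ('k \<times> 'k) set" where
  "induced A S = A \<inter> S \<times> S"

definition acyclic_set :: "('k \<times> 'k) set \<Rightarrow> 'k set \<Rightarrow> bool" where
  "acyclic_set A S \<longleftrightarrow> acyclic (induced A S)"

definition is_dicycle :: "('k \<times> 'k) set \<Rightarrow> nat \<Rightarrow> 'k set \<Rightarrow> bool" where
  "is_dicycle A n S \<longleftrightarrow>
     (\<exists>v :: nat \<Rightarrow> 'k. inj_on v {..<n} \<and> S = v ` {..<n} \<and>
        induced A S = {(v i, v (Suc i mod n)) | i. i < n})"

definition symmetric_part :: "('k \<times> 'k) set \<Rightarrow> 'k set set" where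
  "symmetric_part A = {{u, v} | u v. (u, v) \<in> A \<and> (v, u) \<in> A}"

definition graph_clique :: "'k set set \<Rightarrow> 'k set \<Rightarrow> bool" where
  "graph_clique E Q \<longleftrightarrow> (\<forall>u\<in>Q. \<forall>v\<in>Q. u \<noteq> v \<longrightarrow> {u, v} \<in> E)"

definition digraph_clique :: "('k \<times> 'k) set \<Rightarrow> 'k set \<Rightarrow> bool" where
  "digraph_clique A Q \<longleftrightarrow> (\<forall>u\<in>Q. \<forall>v\<in>Q. u \<noteq> v \<longrightarrow> (u, v) \<in> A \<and> (v, u) \<in> A)"

definition maximal_sets :: "('k set \<Rightarrow> bool) \<Rightarrow> 'k set set" where
  "maximal_sets C = {Q. C Q \<and> (\<forall>Q'. C Q' \<and> Q \<subseteq> Q' \<longrightarrow> Q' = Q)}"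

lemma graph_clique_symmetric_part:
  "graph_clique (symmetric_part A) Q \<longleftrightarrow> digraph_clique A Q"
  unfolding graph_clique_def digraph_clique_def symmetric_part_def
  by (auto simp: doubleton_eq_iff)

definition incidence_vector :: "'k set \<Rightarrow> real ^ 'k" where
  "incidence_vector Q = (\<chi> k. if k \<in> Q then 1 else 0)"

text \<open>A matrix with columns \<open>'k\<close> is given by a set \<open>I\<close> of row indices and its rows \<open>M r\<close>,
  \<open>r \<in> I\<close>. The clique-vertex incidence matrix has \<open>I\<close> the set of maximal cliques and
  \<open>M = incidence_vector\<close>.\<close>

definition perfect_matrix :: "'r set \<Rightarrow> ('r \<Rightarrow> real ^ 'k::finite) \<Rightarrow> bool" where
  "perfect_matrix I M \<longleftrightarrow>
     (\<forall>r\<in>I. \<forall>k. M r $ k \<in> {0, 1}) \<and>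
     (\<forall>x. x extreme_point_of
            {x. (\<forall>k. 0 \<le> x $ k \<and> x $ k \<le> 1) \<and> (\<forall>r\<in>I. (\<Sum>k\<in>UNIV. M r $ k * x $ k) \<le> 1)}
          \<longrightarrow> (\<forall>k. x $ k \<in> \<int>))"

definition set_packing_polytope :: "'k::finite set set \<Rightarrow> (real ^ 'k) set" where
  "set_packing_polytope E =
     {d. (\<forall>k. 0 \<le> d $ k \<and> d $ k \<le> 1) \<and>
         (\<forall>Q \<in> maximal_sets (graph_clique E). (\<Sum>k\<in>Q. d $ k) \<le> 1)}"


section \<open>The channel\<close>

text \<open>\<open>h t j i\<close> is the coefficient from transmitter \<open>i\<close> to receiver \<open>j\<close> at time \<open>t\<close>.
  Since the transmitters know nothing but the topology, a code has to work for every
  realization \<open>h\<close> whose coefficients on the links of the topology are bounded away from zero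
  and infinity. (Without the lower bound, no positive rate could be guaranteed at finite
  power.)\<close>

type_synonym 'k channel = "nat \<Rightarrow> 'k \<Rightarrow> 'k \<Rightarrow> complex"

definition channels :: "real \<Rightarrow> real \<Rightarrow> ('k \<Rightarrow> 'k set) \<Rightarrow> 'k channel set" where
  "channels hmin hmax T =
     {h. \<forall>t j. \<forall>i \<in> T j. hmin \<le> cmod (h t j i) \<and> cmod (h t j i) \<le> hmax}"

text \<open>Circularly symmetric complex Gaussian with zero mean and unit variance.\<close>

definition complex_gaussian :: "complex measure" where
  "complex_gaussian =
     (let N = density lborel (\<lambda>x. ennreal (normal_density 0 (sqrt (1 / 2)) x))
      in distr (N \<Otimes>\<^sub>M N) borel (\<lambda>(x, y). Complex x y))"

lemma measurable_Complex_pair [measurable]: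
  "(\<lambda>(x, y). Complex x y) \<in> borel \<Otimes>\<^sub>M borel \<rightarrow>\<^sub>M borel"
  unfolding Complex_eq case_prod_beta by measurable

lemma sets_complex_gaussian [measurable_cong, simp]: "sets complex_gaussian = sets borel"
  by (simp add: complex_gaussian_def Let_def)

lemma prob_space_complex_gaussian: "prob_space complex_gaussian"
proof -
  let ?N = "density lborel (\<lambda>x. ennreal (normal_density 0 (sqrt (1 / 2)) x))"
  interpret N: prob_space ?N
    by (rule prob_space_normal_density) simp
  interpret NN: pair_prob_space ?N ?N ..
  show ?thesis
    unfolding complex_gaussian_def Let_def
    by (rule NN.prob_space_distr) measurable
qed

text \<open>Noise samples \<open>z (j, t)\<close> are i.i.d. over receivers \<open>j\<close> and times \<open>t < n\<close>.\<close>

definition noise :: "nat \<Rightarrow> ('k::finite \<times> nat \<Rightarrow> complex) measure" where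
  "noise n = PiM (UNIV \<times> {..<n}) (\<lambda>_. complex_gaussian)"

definition received ::
    "('k::finite \<Rightarrow> 'k set) \<Rightarrow> 'k channel \<Rightarrow> nat \<Rightarrow> ('k \<Rightarrow> nat \<Rightarrow> complex) \<Rightarrow>
     ('k \<times> nat \<Rightarrow> complex) \<Rightarrow> 'k \<Rightarrow> nat \<Rightarrow> complex" where
  "received T h n x z j = (\<lambda>t\<in>{..<n}. (\<Sum>i\<in>T j. h t j i * x i t) + z (j, t))"


section \<open>Codes with decoded message passing\<close>

text \<open>\<open>(i, j) \<in> prec\<close> means that message \<open>i\<close> is decoded before message \<open>j\<close>.\<close>

definition decoding_order :: "('k \<times> 'k) set \<Rightarrow> bool" where
  "decoding_order prec \<longleftrightarrow> irrefl prec \<and> trans prec"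

text \<open>\<open>g j y m\<close> is the output of decoder \<open>j\<close> on received word \<open>y\<close> and passed messages \<open>m\<close>;
  \<open>m\<close> is restricted to the users preceding \<open>j\<close>.\<close>

definition decoded ::
    "('k \<times> 'k) set \<Rightarrow> ('k \<Rightarrow> (nat \<Rightarrow> complex) \<Rightarrow> ('k \<Rightarrow> nat) \<Rightarrow> nat) \<Rightarrow>
     ('k \<Rightarrow> nat \<Rightarrow> complex) \<Rightarrow> 'k \<Rightarrow> nat" where
  "decoded prec g y = wfrec prec (\<lambda>m j. g j (y j) (restrict m {k. (k, j) \<in> prec}))"

lemma decoded_eq:
  fixes prec :: "('k::finite \<times> 'k) set"
  assumes "decoding_order prec"
  shows "decoded prec g y j = g j (y j) (restrict (decoded prec g y) {k. (k, j) \<in> prec})"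
proof -
  have "acyclic prec"
    using assms by (simp add: decoding_order_def acyclic_irrefl)
  then have "wf prec"
    by (simp add: finite_acyclic_wf)
  moreover have "restrict (cut f prec j) {k. (k, j) \<in> prec} = restrict f {k. (k, j) \<in> prec}"
    for f :: "'k \<Rightarrow> nat"
    by (auto simp: restrict_def cut_def)
  ultimately show ?thesis
    unfolding decoded_def by (subst wfrec) simp_all
qed

definition num_messages :: "nat \<Rightarrow> real ^ 'k \<Rightarrow> 'k \<Rightarrow> nat" where
  "num_messages n R i = nat \<lfloor>2 powr (real n * R $ i)\<rfloor>"

definition messages :: "('k \<Rightarrow> nat) \<Rightarrow> ('k \<Rightarrow> nat) measure" where
  "messages M = uniform_count_measure {w. \<forall>i. w i \<in> {1..M i}}"

text \<open>\<open>f i w t\<close> is the symbol sent by user \<open>i\<close> at time \<open>t\<close> for message \<open>w\<close>.\<close>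

definition power_constraint ::
    "nat \<Rightarrow> real \<Rightarrow> ('k \<Rightarrow> nat) \<Rightarrow> ('k \<Rightarrow> nat \<Rightarrow> nat \<Rightarrow> complex) \<Rightarrow> bool" where
  "power_constraint n P M f \<longleftrightarrow>
     (\<forall>i. (\<Sum>w\<in>{1..M i}. (\<Sum>t<n. (cmod (f i w t))\<^sup>2) / real n) / real (M i) \<le> P)"

definition error_prob ::
    "('k::finite \<Rightarrow> 'k set) \<Rightarrow> 'k channel \<Rightarrow> ('k \<times> 'k) set \<Rightarrow> nat \<Rightarrow> ('k \<Rightarrow> nat) \<Rightarrow>
     ('k \<Rightarrow> nat \<Rightarrow> nat \<Rightarrow> complex) \<Rightarrow>
     ('k \<Rightarrow> (nat \<Rightarrow> complex) \<Rightarrow> ('k \<Rightarrow> nat) \<Rightarrow> nat) \<Rightarrow> 'k \<Rightarrow> real" where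
  "error_prob T h prec n M f g j =
     \<P>(\<omega> in messages M \<Otimes>\<^sub>M noise n.
        decoded prec g (received T h n (\<lambda>i. f i (fst \<omega> i)) (snd \<omega>)) j \<noteq> fst \<omega> j)"

text \<open>The rate tuples achievable under \<open>prec\<close> at power \<open>P\<close> with only the users in \<open>S\<close> active.
  Encoders \<open>f n\<close> do not depend on the channel realization \<open>h\<close>, decoders \<open>g n h\<close> do.
  Measurability of the decoders makes the error event measurable.\<close>

definition rate_region_active ::
    "real \<Rightarrow> real \<Rightarrow> ('k::finite \<Rightarrow> 'k set) \<Rightarrow> real \<Rightarrow> 'k set \<Rightarrow> ('k \<times> 'k) set \<Rightarrow>
     (real ^ 'k) set" where
  "rate_region_active hmin hmax T P S prec =
     {R. (\<forall>i. 0 \<le> R $ i) \<and>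
         (\<exists>(f :: nat \<Rightarrow> 'k \<Rightarrow> nat \<Rightarrow> nat \<Rightarrow> complex)
           (g :: nat \<Rightarrow> 'k channel \<Rightarrow> 'k \<Rightarrow> (nat \<Rightarrow> complex) \<Rightarrow> ('k \<Rightarrow> nat) \<Rightarrow> nat).
            (\<forall>n. power_constraint n P (num_messages n R) (f n)) \<and>
            (\<forall>n. \<forall>i. i \<notin> S \<longrightarrow> (\<forall>w t. f n i w t = 0)) \<and>
            (\<forall>n h j m. (\<lambda>y. g n h j y m) \<in> PiM {..<n} (\<lambda>_. borel) \<rightarrow>\<^sub>M count_space UNIV) \<and>
            (\<forall>h \<in> channels hmin hmax T.
               (\<lambda>n. MAX j. error_prob T h prec n (num_messages n R) (f n) (g n h) j)
                 \<longlonglongrightarrow> 0))}"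

definition rate_region ::
    "real \<Rightarrow> real \<Rightarrow> ('k::finite \<Rightarrow> 'k set) \<Rightarrow> real \<Rightarrow> ('k \<times> 'k) set \<Rightarrow> (real ^ 'k) set" where
  "rate_region hmin hmax T P prec = rate_region_active hmin hmax T P UNIV prec"

definition capacity_region ::
    "real \<Rightarrow> real \<Rightarrow> ('k::finite \<Rightarrow> 'k set) \<Rightarrow> real \<Rightarrow> (real ^ 'k) set" where
  "capacity_region hmin hmax T P =
     convex hull (\<Union>prec \<in> {prec. decoding_order prec}. rate_region hmin hmax T P prec)"

text \<open>Orthogonal access: in one round an acyclic set \<open>S\<close> is active and every receiver in \<open>S\<close>
  decodes after all its interferers in \<open>S\<close>; rounds are combined by time sharing.\<close>

definition orthogonal_access_region ::
    "real \<Rightarrow> real \<Rightarrow> ('k::finite \<Rightarrow> 'k set) \<Rightarrow> real \<Rightarrow> (real ^ 'k) set" where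
  "orthogonal_access_region hmin hmax T P =
     convex hull (\<Union>(S, prec) \<in> {(S, prec). acyclic_set (conflict_digraph T) S \<and>
                                   decoding_order prec \<and> induced (conflict_digraph T) S \<subseteq> prec}.
                    rate_region_active hmin hmax T P S prec)"

text \<open>The DoF tuples of power-indexed rate regions \<open>C P\<close>. The limit superior of
  \<open>R / log P\<close> as \<open>P\<close> tends to infinity is taken jointly in all coordinates, that is, along a
  common sequence of powers: taken in each coordinate separately, rates that
  alternate with \<open>P\<close> between \<open>(log P, 0)\<close> and \<open>(0, log P)\<close> would count as the DoF pair
  \<open>(1, 1)\<close>.\<close>

definition dof_tuples :: "(real \<Rightarrow> (real ^ 'k::finite) set) \<Rightarrow> (real ^ 'k) set" where
  "dof_tuples C =
     {d. \<exists>(P :: nat \<Rightarrow> real) (R :: nat \<Rightarrow> real ^ 'k).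
           filterlim P at_top sequentially \<and> (\<forall>m. R m \<in> C (P m)) \<and>
           (\<forall>i. (\<lambda>m. R m $ i / log 2 (P m)) \<longlonglongrightarrow> d $ i)}"

definition dof_region :: "real \<Rightarrow> real \<Rightarrow> ('k::finite \<Rightarrow> 'k set) \<Rightarrow> (real ^ 'k) set" where
  "dof_region hmin hmax T = dof_tuples (capacity_region hmin hmax T)"

definition orthogonal_access_dof_region ::
    "real \<Rightarrow> real \<Rightarrow> ('k::finite \<Rightarrow> 'k set) \<Rightarrow> (real ^ 'k) set" where
  "orthogonal_access_dof_region hmin hmax T = dof_tuples (orthogonal_access_region hmin hmax T)"

end

theory Submission
  imports Defs
begin

text \<open>
  Without induced dicycles of length at least three, a set of users is acyclic as soon as it
  contains no two users joined by arcs in both directions: a shortest directed cycle has no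
  chords. Perfection makes the extreme points of the set packing polytope incidence vectors of
  such sets, so the polytope is the convex hull of the acyclic sets.

  Upper bound: on the channel with all coefficients equal to \<open>hmin\<close>, the users of a clique are
  received as one sum signal by each receiver of the clique, and one receiver can decode all of
  them. Comparing the conditional output densities with one Gaussian of variance \<open>1 + P\<close> bounds
  the number of message tuples by \<open>(1 + P) ^ n * exp (O(n))\<close>.

  Lower bound: greedy packing in an integer grid gives codes of rate \<open>log P - O(1)\<close> whose minimum
  distance exceeds twice the typical noise radius on every admissible channel, so a
  threshold decoder that first cancels the decoded interferers succeeds for all users of an acyclic
  set.
\<close>

section \<open>The set packing polytope and acyclic sets\<close>

text \<open>Encoders are fixed before the channel is, and one code has to serve every admissible
  realization. For the converse this is an advantage: it suffices to test the code on an admissible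
  channel that makes the receivers of a clique interchangeable. For achievability it is the
  obstacle: a random code is good on average for each single channel, but here one code must be good
  for all of them. Minimum distance belongs to the code alone, and coefficients of modulus at least
  \<open>hmin\<close> shrink it by a bounded factor; hence codes of large distance and a threshold
  decoder. Division by \<open>log 2 (P m)\<close> removes every additive constant of the rates. This
  permits crude steps: a volume count instead of mutual information in the converse, an uncentred
  grid and a lossy packing bound in the code construction. The threshold of 4 per noise symbol is
  chosen because \<open>2 * exp (- 2) < 1\<close>, and the distance \<open>16 / hmin^2\<close> per
  symbol follows from it. Clique inequalities limit every scheme, while time sharing reaches the
  hull of the acyclic sets; perfection is what makes these two polytopes meet.\<close>

lemma ex_maximal_digraph_clique:
  fixes A :: "('k::finite \<times> 'k) set"
  assumes "digraph_clique A Q"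
  obtains Q' where "Q' \<in> maximal_sets (digraph_clique A)" "Q \<subseteq> Q'"
proof -
  obtain Q' where "Q \<subseteq> Q'" "digraph_clique A Q'"
      "\<And>R. digraph_clique A R \<Longrightarrow> Q' \<subseteq> R \<Longrightarrow> R = Q'"
    using finite_has_maximal2[of "{R. digraph_clique A R}" Q] assms by auto
  then show ?thesis
    using that[of Q'] unfolding maximal_sets_def by blast
qed

lemma acyclic_set_if_no_dicycle:
  fixes A :: "('k \<times> 'k) set"
  assumes no_loop: "\<And>v. v \<in> S \<Longrightarrow> (v, v) \<notin> A"
    and no_digon: "\<And>u v. u \<in> S \<Longrightarrow> v \<in> S \<Longrightarrow> (u, v) \<in> A \<Longrightarrow> (v, u) \<notin> A"
    and no_dicycle: "\<And>n S'. 3 \<le> n \<Longrightarrow> \<not> is_dicycle A n S'"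
  shows "acyclic_set A S"
  unfolding acyclic_set_def
proof (rule acyclicI, intro allI notI)
  let ?B = "induced A S"
  fix a assume "(a, a) \<in> ?B\<^sup>+"
  then have ex: "\<exists>n. 0 < n \<and> (\<exists>a. (a, a) \<in> ?B ^^ n)"
    by (meson trancl_power)
  \<comment> \<open>Minimality is taken over closed walks, not cycles; that the vertices are
    distinct and that there are no chords then both follow from it.\<close>
  define n where "n = (LEAST n. 0 < n \<and> (\<exists>a. (a, a) \<in> ?B ^^ n))"
  have n: "0 < n" "\<exists>a. (a, a) \<in> ?B ^^ n"
    using LeastI_ex[OF ex] unfolding n_def by auto
  have minimal: "n \<le> m" if "0 < m" "(x, x) \<in> ?B ^^ m" for m x
    unfolding n_def using that by (intro Least_le) auto
  obtain v where v: "v n = v 0" "\<And>i. i < n \<Longrightarrow> (v i, v (Suc i)) \<in> ?B"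
    using n(2) unfolding relpow_fun_conv by auto
  have in_S: "v i \<in> S" if "i < n" for i
    using v(2)[OF that] by (auto simp: induced_def)
  have arc: "(v i, v (Suc i mod n)) \<in> ?B" if "i < n" for i
    using v(2)[OF that] v(1) that by (cases "Suc i = n") auto
  have walk: "(v i, v j) \<in> ?B ^^ (j - i)" if "i \<le> j" "j \<le> n" for i j
    using that
  proof (induction j rule: dec_induct)
    case (step j)
    then have "(v i, v (Suc j)) \<in> ?B ^^ Suc (j - i)"
      using v(2)[of j] by auto
    then show ?case
      using step.hyps by (simp add: Suc_diff_le)
  qed simp
  \<comment> \<open>A chord closes up with part of the walk. If \<open>j \<le> i\<close>, the
    segment from \<open>v j\<close> to \<open>v i\<close> and the chord have total length
    \<open>i - j + 1\<close>, and minimality forces \<open>j = 0\<close> and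
    \<open>i = n - 1\<close>. Otherwise the way from \<open>v j\<close> through \<open>v 0\<close>
    to \<open>v i\<close> and the chord has length \<open>n - j + i + 1\<close>, which forces
    \<open>j = i + 1\<close>.\<close>
  have chord: "j = Suc i mod n" if "i < n" "j < n" "(v i, v j) \<in> ?B" for i j
  proof (cases "j \<le> i")
    case True
    then have "(v j, v j) \<in> ?B ^^ Suc (i - j)"
      using walk[of j i] that by auto
    then have "n \<le> Suc (i - j)"
      by (intro minimal) auto
    then have "j = 0" "Suc i = n"
      using that True by auto
    then show ?thesis by simp
  next
    case False
    have "(v j, v i) \<in> ?B ^^ ((n - j) + i)"
      using walk[of j n] walk[of 0 i] that v(1) unfolding relpow_add by auto
    then have "(v j, v j) \<in> ?B ^^ Suc ((n - j) + i)"
      using that by auto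
    then have "n \<le> Suc ((n - j) + i)"
      by (intro minimal) auto
    then show ?thesis
      using False that by auto
  qed
  have inj: "inj_on v {..<n}"
  proof (rule linorder_inj_onI)
    fix i j assume ij: "i < j" "j \<in> {..<n}"
    show "v i \<noteq> v j"
    proof
      assume "v i = v j"
      then have "n \<le> j - i"
        using walk[of i j] ij by (intro minimal[of "j - i" "v i"]) auto
      then show False
        using ij by auto
    qed
  qed auto
  have "n \<noteq> 1"
    using arc[of 0] no_loop[of "v 0"] in_S[of 0] by (auto simp: induced_def)
  moreover have "n \<noteq> 2"
    using arc[of 0] arc[of 1] no_digon[of "v 0" "v 1"] in_S[of 0] in_S[of 1]
    by (auto simp: induced_def)
  ultimately have "3 \<le> n"
    using n(1) by simp
  moreover have "is_dicycle A n (v ` {..<n})"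
    unfolding is_dicycle_def
  proof (intro exI[of _ v] conjI inj refl)
    show "induced A (v ` {..<n}) = {(v i, v (Suc i mod n)) |i. i < n}"
    proof (intro equalityI subsetI)
      fix p assume "p \<in> induced A (v ` {..<n})"
      then obtain i j where ij: "p = (v i, v j)" "i < n" "j < n" "(v i, v j) \<in> A"
        by (auto simp: induced_def)
      then have "(v i, v j) \<in> ?B"
        using in_S by (auto simp: induced_def)
      then show "p \<in> {(v i, v (Suc i mod n)) |i. i < n}"
        using chord[of i j] ij by auto
    next
      fix p assume "p \<in> {(v i, v (Suc i mod n)) |i. i < n}"
      then show "p \<in> induced A (v ` {..<n})"
        using arc n(1) by (fastforce simp: induced_def)
    qed
  qed
  ultimately show False
    using no_dicycle by blast
qed

text \<open>This is the literal shape of the set inside \<open>perfect_matrix\<close>, so the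
  hypothesis on its extreme points can be used by rewriting.\<close>

lemma set_packing_polytope_symmetric_part:
  "set_packing_polytope (symmetric_part A) =
     {d. (\<forall>k. 0 \<le> d $ k \<and> d $ k \<le> 1) \<and>
         (\<forall>Q\<in>maximal_sets (digraph_clique A). (\<Sum>k\<in>UNIV. incidence_vector Q $ k * d $ k) \<le> 1)}"
proof -
  have "(\<Sum>k\<in>UNIV. incidence_vector Q $ k * d $ k) = (\<Sum>k\<in>Q. d $ k)"
    for Q :: "'a set" and d :: "real ^ 'a"
    unfolding incidence_vector_def by (simp add: if_distrib[of "\<lambda>x. x * _"] sum.If_cases)
  moreover have "graph_clique (symmetric_part A) = digraph_clique A"
    using graph_clique_symmetric_part by auto
  ultimately show ?thesis
    unfolding set_packing_polytope_def by simp
qed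

text \<open>Coordinates are nonnegative, so a clique inherits the inequality of any maximal clique
  above it. It is applied to pairs, which are rarely maximal.\<close>

lemma set_packing_polytope_clique_le:
  fixes A :: "('k::finite \<times> 'k) set"
  assumes "d \<in> set_packing_polytope (symmetric_part A)" "digraph_clique A Q"
  shows "(\<Sum>k\<in>Q. d $ k) \<le> 1"
proof -
  obtain Q' where Q': "Q' \<in> maximal_sets (digraph_clique A)" "Q \<subseteq> Q'"
    using ex_maximal_digraph_clique[OF assms(2)] .
  have "graph_clique (symmetric_part A) = digraph_clique A"
    using graph_clique_symmetric_part by auto
  then have "(\<Sum>k\<in>Q'. d $ k) \<le> 1" and "\<And>k. 0 \<le> d $ k"
    using assms(1) Q'(1) unfolding set_packing_polytope_def by auto
  moreover have "(\<Sum>k\<in>Q. d $ k) \<le> (\<Sum>k\<in>Q'. d $ k)"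
    using Q'(2) \<open>\<And>k. 0 \<le> d $ k\<close> by (intro sum_mono2) auto
  ultimately show ?thesis
    by linarith
qed

text \<open>The polytope is compact and convex, hence the hull of its extreme points by
  Krein-Milman-Minkowski. Only these have to be identified with acyclic sets.\<close>

lemma set_packing_polytope_subset_hull:
  fixes A :: "('k::finite \<times> 'k) set"
  assumes no_loop: "\<And>v. (v, v) \<notin> A"
    and no_dicycle: "\<And>n S. 3 \<le> n \<Longrightarrow> \<not> is_dicycle A n S"
    and perfect: "perfect_matrix (maximal_sets (digraph_clique A)) incidence_vector"
  shows "set_packing_polytope (symmetric_part A)
           \<subseteq> convex hull (incidence_vector ` {S. acyclic_set A S})"
proof -
  let ?P = "set_packing_polytope (symmetric_part A)"
  have "?P = {d. \<forall>k. 0 \<le> d $ k} \<inter> {d. \<forall>k. d $ k \<le> 1} \<inter>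
      (\<Inter>Q\<in>maximal_sets (graph_clique (symmetric_part A)). {d. (\<Sum>k\<in>Q. d $ k) \<le> 1})"
    unfolding set_packing_polytope_def by auto
  moreover have "closed \<dots>"
    by (intro closed_Int closed_INT ballI closed_Collect_le closed_Collect_all continuous_intros)
  ultimately have "closed ?P" by simp
  moreover have "?P \<subseteq> cbox 0 1"
    unfolding set_packing_polytope_def mem_box_cart subset_eq by auto
  ultimately have "compact ?P"
    by (meson bounded_cbox bounded_subset compact_eq_bounded_closed)
  moreover have "convex ?P"
    unfolding convex_def
  proof (intro ballI allI impI)
    fix x y :: "real ^ 'k" and u v :: real
    assume *: "x \<in> ?P" "y \<in> ?P" "0 \<le> u" "0 \<le> v" "u + v = 1"
    have 1: "u * a + v * b \<le> 1" if "a \<le> 1" "b \<le> 1" for a b :: real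
      using convex_bound_le[of a 1 b u v] that * by simp
    have "(\<Sum>k\<in>Q. (u *\<^sub>R x + v *\<^sub>R y) $ k) = u * (\<Sum>k\<in>Q. x $ k) + v * (\<Sum>k\<in>Q. y $ k)" for Q
      by (simp add: sum.distrib sum_distrib_left)
    then show "u *\<^sub>R x + v *\<^sub>R y \<in> ?P"
      using * 1 unfolding set_packing_polytope_def by auto
  qed
  ultimately have "?P = convex hull {x. x extreme_point_of ?P}"
    by (rule Krein_Milman_Minkowski)
  moreover have "{x. x extreme_point_of ?P} \<subseteq> incidence_vector ` {S. acyclic_set A S}"
  proof
    fix x assume "x \<in> {x. x extreme_point_of ?P}"
    then have x: "x extreme_point_of ?P" by simp
    then have mem: "x \<in> ?P" by (simp add: extreme_point_of_def)
    have "x $ k \<in> \<int>" for k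
      using perfect x unfolding perfect_matrix_def set_packing_polytope_symmetric_part by blast
    moreover have "0 \<le> x $ k" "x $ k \<le> 1" for k
      using mem unfolding set_packing_polytope_def by auto
    ultimately have x01: "x $ k = 0 \<or> x $ k = 1" for k
      by (metis Ints_cases linorder_not_le of_int_0 of_int_0_le_iff of_int_1 of_int_le_1_iff order_antisym
          int_one_le_iff_zero_less)
    define S where "S = {k. x $ k = 1}"
    have "x = incidence_vector S"
      unfolding incidence_vector_def S_def vec_eq_iff using x01 by auto
    \<comment> \<open>Two members of \<open>S\<close> joined in both directions would form a clique
      of weight 2, against the clique inequality.\<close>
    moreover have "acyclic_set A S"
    proof (rule acyclic_set_if_no_dicycle)
      fix u v assume uv: "u \<in> S" "v \<in> S" "(u, v) \<in> A"
      show "(v, u) \<notin> A"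
      proof
        assume "(v, u) \<in> A"
        then have "digraph_clique A {u, v}"
          using uv unfolding digraph_clique_def by auto
        then have "(\<Sum>k\<in>{u, v}. x $ k) \<le> 1"
          using set_packing_polytope_clique_le[OF mem] by blast
        then show False
          using uv no_loop by (cases "u = v") (auto simp: S_def)
      qed
    qed (use assms in auto)
    ultimately show "x \<in> incidence_vector ` {S. acyclic_set A S}" by blast
  qed
  ultimately show ?thesis
    by (metis hull_mono)
qed

section \<open>Complex Gaussian noise\<close>

text \<open>The total variance \<open>v\<close> is split equally between real and imaginary part.
  The instance \<open>1 + P\<close> is the reference output law of the converse.\<close>

definition complex_normal :: "real \<Rightarrow> complex measure" where
  "complex_normal v =
     (let N = density lborel (\<lambda>x. ennreal (normal_density 0 (sqrt (v / 2)) x))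
      in distr (N \<Otimes>\<^sub>M N) borel (\<lambda>(x, y). Complex x y))"

lemma complex_gaussian_eq_normal: "complex_gaussian = complex_normal 1"
  by (simp add: complex_gaussian_def complex_normal_def)

lemma sets_complex_normal [measurable_cong, simp]: "sets (complex_normal v) = sets borel"
  by (simp add: complex_normal_def Let_def)

lemma prob_space_complex_normal:
  assumes "0 < v"
  shows "prob_space (complex_normal v)"
proof -
  let ?N = "density lborel (\<lambda>x. ennreal (normal_density 0 (sqrt (v / 2)) x))"
  interpret N: prob_space ?N
    using assms by (intro prob_space_normal_density) simp
  interpret NN: pair_prob_space ?N ?N ..
  show ?thesis
    unfolding complex_normal_def Let_def
    by (rule NN.prob_space_distr) measurable
qed

text \<open>Reduces complex integrals to iterated Lebesgue integrals, where translations and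
  comparisons of densities can be made one real coordinate at a time.\<close>

lemma nn_integral_complex_normal:
  assumes "0 < v" and [measurable]: "F \<in> borel_measurable borel"
  shows "(\<integral>\<^sup>+z. F z \<partial>complex_normal v) =
    (\<integral>\<^sup>+x. \<integral>\<^sup>+y. ennreal (normal_density 0 (sqrt (v / 2)) x * normal_density 0 (sqrt (v / 2)) y)
       * F (Complex x y) \<partial>lborel \<partial>lborel)"
proof -
  let ?d = "normal_density 0 (sqrt (v / 2))"
  let ?N = "density lborel (\<lambda>x. ennreal (?d x))"
  interpret N: prob_space ?N
    using assms by (intro prob_space_normal_density) simp
  have "(\<lambda>x. F (Complex (fst x) (snd x))) \<in> borel_measurable (borel \<Otimes>\<^sub>M borel)"
    using measurable_compose[OF measurable_Complex_pair assms(2)] by (simp add: case_prod_beta)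
  note [measurable] = this
  have [measurable]: "(\<lambda>y. F (Complex x y)) \<in> borel_measurable borel" for x
    using measurable_compose[OF measurable_Pair1' [of x borel borel]
        \<open>(\<lambda>x. F (Complex (fst x) (snd x))) \<in> _\<close>] by simp
  have "(\<integral>\<^sup>+z. F z \<partial>complex_normal v) = (\<integral>\<^sup>+p. F (Complex (fst p) (snd p)) \<partial>(?N \<Otimes>\<^sub>M ?N))"
    unfolding complex_normal_def Let_def
    by (subst nn_integral_distr) (auto simp: case_prod_beta)
  also have "\<dots> = (\<integral>\<^sup>+x. \<integral>\<^sup>+y. F (Complex x y) \<partial>?N \<partial>?N)"
    by (subst N.nn_integral_fst[symmetric]) auto
  also have "\<dots> = (\<integral>\<^sup>+x. ennreal (?d x) * (\<integral>\<^sup>+y. F (Complex x y) \<partial>?N) \<partial>lborel)"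
  proof (rule nn_integral_density)
    have "(\<lambda>x. \<integral>\<^sup>+y. F (Complex (fst (x, y)) (snd (x, y))) \<partial>?N) \<in> borel_measurable borel"
      by (rule N.borel_measurable_nn_integral) simp
    then show "(\<lambda>x. \<integral>\<^sup>+y. F (Complex x y) \<partial>?N) \<in> borel_measurable lborel" by simp
  qed simp
  also have "\<dots> = (\<integral>\<^sup>+x. ennreal (?d x) * (\<integral>\<^sup>+y. ennreal (?d y) * F (Complex x y) \<partial>lborel) \<partial>lborel)"
    by (subst nn_integral_density) auto
  also have "\<dots> = (\<integral>\<^sup>+x. \<integral>\<^sup>+y. ennreal (?d x * ?d y) * F (Complex x y) \<partial>lborel \<partial>lborel)"
    by (subst nn_integral_cmult[symmetric]) (auto simp: ennreal_mult mult.assoc)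
  finally show ?thesis .
qed

text \<open>Completing the square in \<open>x\<close>: with \<open>v = 1 + P\<close>, the difference
  of the exponents is maximal at \<open>x = v * a / P\<close> and equals \<open>a^2 / P\<close>
  there. The factor \<open>sqrt (1 + P)\<close> is the ratio of the normalizing constants.\<close>

lemma normal_density_shift_le:
  fixes P :: real
  assumes "0 < P"
  shows "normal_density 0 (sqrt (1 / 2)) (x - a)
    \<le> sqrt (1 + P) * exp (a\<^sup>2 / P) * normal_density 0 (sqrt ((1 + P) / 2)) x"
proof -
  let ?v = "1 + P"
  have "x\<^sup>2 / ?v - (x - a)\<^sup>2 - a\<^sup>2 / P = - (P * x - ?v * a)\<^sup>2 / (?v * P)"
    using assms by (simp add: field_simps power2_eq_square)
  also have "\<dots> \<le> 0"
    using assms by (simp add: divide_nonneg_pos)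
  finally have "exp (- (x - a)\<^sup>2) \<le> exp (a\<^sup>2 / P - x\<^sup>2 / ?v)"
    by simp
  then have "exp (- (x - a)\<^sup>2) / sqrt pi \<le> exp (a\<^sup>2 / P - x\<^sup>2 / ?v) / sqrt pi"
    by (intro divide_right_mono) auto
  moreover have "normal_density 0 (sqrt (1 / 2)) (x - a) = exp (- (x - a)\<^sup>2) / sqrt pi"
    by (simp add: normal_density_def)
  moreover have e: "normal_density 0 (sqrt (?v / 2)) x = exp (- (x\<^sup>2 / ?v)) / (sqrt ?v * sqrt pi)"
    using assms by (simp add: normal_density_def real_sqrt_mult[symmetric] mult.commute) (simp add: field_simps)
  have "sqrt ?v * exp (a\<^sup>2 / P) * normal_density 0 (sqrt (?v / 2)) x =
      exp (a\<^sup>2 / P - x\<^sup>2 / ?v) / sqrt pi"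
    using assms unfolding e by (simp add: exp_diff exp_minus divide_inverse)
  ultimately show ?thesis by simp
qed

text \<open>The ratio of the Gaussian density centred at \<open>s\<close> to the centred Gaussian density of
  variance \<open>1 + P\<close> is bounded; for a shift of energy about \<open>P\<close> the bound is of order \<open>P\<close>.\<close>

lemma nn_integral_complex_gaussian_shift_le:
  assumes "0 < P" and [measurable]: "F \<in> borel_measurable borel"
  shows "(\<integral>\<^sup>+z. F (z + s) \<partial>complex_gaussian)
    \<le> ennreal ((1 + P) * exp ((cmod s)\<^sup>2 / P)) * (\<integral>\<^sup>+z. F z \<partial>complex_normal (1 + P))"
proof -
  define d e where "d = normal_density 0 (sqrt (1 / 2))" and "e = normal_density 0 (sqrt ((1 + P) / 2))"
  have [measurable]: "d \<in> borel_measurable borel" "e \<in> borel_measurable borel"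
    unfolding d_def e_def by auto
  have nonneg: "0 \<le> d x" "0 \<le> e x" for x
    unfolding d_def e_def by auto
  have pair [measurable]: "(\<lambda>x. F (Complex (fst x) (snd x))) \<in> borel_measurable (borel \<Otimes>\<^sub>M borel)"
    using measurable_compose[OF measurable_Complex_pair assms(2)] by (simp add: case_prod_beta)
  have [measurable]: "(\<lambda>y. F (Complex x y)) \<in> borel_measurable borel" for x
    using measurable_compose[OF measurable_Pair1' [of x borel borel] pair] by simp
  let ?a = "Re s" and ?b = "Im s"
  let ?c = "(1 + P) * exp ((cmod s)\<^sup>2 / P)"
  have "(\<integral>\<^sup>+z. F (z + s) \<partial>complex_gaussian) =
      (\<integral>\<^sup>+x. \<integral>\<^sup>+y. ennreal (d x * d y) * F (Complex x y + s) \<partial>lborel \<partial>lborel)"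
    unfolding complex_gaussian_eq_normal d_def by (subst nn_integral_complex_normal) auto
  also have "\<dots> = (\<integral>\<^sup>+x. \<integral>\<^sup>+y. ennreal (d x * d (y - ?b)) * F (Complex (x + ?a) y) \<partial>lborel \<partial>lborel)"
  proof (rule nn_integral_cong)
    fix x
    have "Complex x y + s = Complex (x + ?a) (?b + y)" for y
      by (simp add: complex_eq_iff)
    then show "(\<integral>\<^sup>+y. ennreal (d x * d y) * F (Complex x y + s) \<partial>lborel) =
        (\<integral>\<^sup>+y. ennreal (d x * d (y - ?b)) * F (Complex (x + ?a) y) \<partial>lborel)"
      using nn_integral_real_affine[of "\<lambda>y. ennreal (d x * d (y - ?b)) * F (Complex (x + ?a) y)" 1 ?b]
      by simp
  qed
  also have "\<dots> = (\<integral>\<^sup>+x. \<integral>\<^sup>+y. ennreal (d (x - ?a) * d (y - ?b)) * F (Complex x y) \<partial>lborel \<partial>lborel)"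
  proof -
    have "(\<lambda>x. \<integral>\<^sup>+y. ennreal (d (fst (x, y) - ?a) * d (snd (x, y) - ?b)) *
        F (Complex (fst (x, y)) (snd (x, y))) \<partial>lborel) \<in> borel_measurable borel"
      by (rule lborel.borel_measurable_nn_integral) simp
    then show ?thesis
      using nn_integral_real_affine[of "\<lambda>x. \<integral>\<^sup>+y. ennreal (d (x - ?a) * d (y - ?b)) * F (Complex x y) \<partial>lborel" 1 ?a]
      by (simp add: add.commute)
  qed
  also have "\<dots> \<le> (\<integral>\<^sup>+x. \<integral>\<^sup>+y. ennreal ?c * (ennreal (e x * e y) * F (Complex x y)) \<partial>lborel \<partial>lborel)"
  proof (intro nn_integral_mono)
    fix x y
    have "d (x - ?a) * d (y - ?b) \<le>
        (sqrt (1 + P) * exp (?a\<^sup>2 / P) * e x) * (sqrt (1 + P) * exp (?b\<^sup>2 / P) * e y)"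
      unfolding d_def e_def using assms(1) by (intro mult_mono normal_density_shift_le) auto
    also have "\<dots> = (sqrt (1 + P) * sqrt (1 + P)) * (exp (?a\<^sup>2 / P) * exp (?b\<^sup>2 / P)) * (e x * e y)"
      by (simp add: ac_simps)
    also have "\<dots> = ?c * (e x * e y)"
      using assms(1) by (simp add: cmod_power2 add_divide_distrib exp_add)
    finally have "ennreal (d (x - ?a) * d (y - ?b)) \<le> ennreal ?c * ennreal (e x * e y)"
      using assms(1) nonneg by (simp add: ennreal_mult[symmetric] ennreal_leI)
    then show "ennreal (d (x - ?a) * d (y - ?b)) * F (Complex x y)
        \<le> ennreal ?c * (ennreal (e x * e y) * F (Complex x y))"
      unfolding mult.assoc[symmetric] by (rule mult_right_mono) simp
  qed
  also have "\<dots> = ennreal ?c * (\<integral>\<^sup>+x. \<integral>\<^sup>+y. ennreal (e x * e y) * F (Complex x y) \<partial>lborel \<partial>lborel)"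
  proof -
    have "(\<lambda>x. \<integral>\<^sup>+y. ennreal (e (fst (x, y)) * e (snd (x, y))) *
        F (Complex (fst (x, y)) (snd (x, y))) \<partial>lborel) \<in> borel_measurable borel"
      by (rule lborel.borel_measurable_nn_integral) simp
    then show ?thesis
      by (simp add: nn_integral_cmult)
  qed
  also have "\<dots> = ennreal ?c * (\<integral>\<^sup>+z. F z \<partial>complex_normal (1 + P))"
    unfolding e_def using assms(1) by (subst nn_integral_complex_normal) auto
  finally show ?thesis .
qed

text \<open>The one-letter density ratios multiply, so their exponents add up to the energy of the
  shift. The induction leaves \<open>F\<close> arbitrary because integrating out one coordinate
  produces a new integrand.\<close>

lemma nn_integral_PiM_complex_gaussian_shift_le:
  assumes "0 < P" "finite I" "F \<in> borel_measurable (PiM I (\<lambda>_. borel))"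
  shows "(\<integral>\<^sup>+z. F (\<lambda>t\<in>I. z t + s t) \<partial>PiM I (\<lambda>_. complex_gaussian))
    \<le> ennreal ((1 + P) ^ card I * exp ((\<Sum>t\<in>I. (cmod (s t))\<^sup>2) / P)) *
       (\<integral>\<^sup>+z. F z \<partial>PiM I (\<lambda>_. complex_normal (1 + P)))"
  using assms(2,3)
proof (induction I arbitrary: F rule: finite_induct)
  case empty
  then show ?case by (simp add: PiM_empty nn_integral_count_space_finite restrict_def)
next
  case (insert i I)
  interpret G: product_sigma_finite "\<lambda>_ :: 'a. complex_gaussian"
    by (intro product_sigma_finite.intro prob_space_imp_sigma_finite prob_space_complex_gaussian)
  interpret N: product_sigma_finite "\<lambda>_ :: 'a. complex_normal (1 + P)"
    using assms(1)
    by (intro product_sigma_finite.intro prob_space_imp_sigma_finite prob_space_complex_normal) simp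
  note [measurable] = insert.prems
  have setsG: "sets (PiM I (\<lambda>_. complex_gaussian)) = sets (PiM I (\<lambda>_. borel))" for I :: "'a set"
    by (intro sets_PiM_cong) auto
  have setsN: "sets (PiM I (\<lambda>_. complex_normal (1 + P))) = sets (PiM I (\<lambda>_. borel))" for I :: "'a set"
    by (intro sets_PiM_cong) auto
  note [measurable_cong] = setsG setsN
  have upd: "(\<lambda>p. (fst p)(i := snd p)) \<in> PiM I (\<lambda>_. borel) \<Otimes>\<^sub>M borel \<rightarrow>\<^sub>M PiM (insert i I) (\<lambda>_. borel :: complex measure)"
    using measurable_add_dim[of i I "\<lambda>_. borel :: complex measure"] by (simp add: case_prod_beta)
  note Fupd = measurable_compose[OF upd insert.prems]
  have Fi [measurable]: "(\<lambda>y. F (x(i := y))) \<in> borel_measurable borel" if "x \<in> space (PiM I (\<lambda>_. borel :: complex measure))" for x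
    using measurable_compose[OF measurable_Pair1'[OF that] Fupd] by (simp add: fun_upd_def)
  have sf: "sigma_finite_measure (complex_normal (1 + P))"
    using assms(1) by (simp add: prob_space_complex_normal prob_space_imp_sigma_finite)
  have inner: "(\<lambda>x. \<integral>\<^sup>+y. F (x(i := y)) \<partial>complex_normal (1 + P)) \<in> borel_measurable (PiM I (\<lambda>_. borel))"
  proof -
    have "(\<lambda>x. \<integral>\<^sup>+y. F ((fst (x, y))(i := snd (x, y))) \<partial>complex_normal (1 + P)) \<in> borel_measurable (PiM I (\<lambda>_. borel))"
      using Fupd by (intro sigma_finite_measure.borel_measurable_nn_integral[OF sf]) (simp add: case_prod_beta cong: measurable_cong_sets)
    then show ?thesis by simp
  qed
  let ?c = "\<lambda>t. (1 + P) * exp ((cmod (s t))\<^sup>2 / P)"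
  let ?C = "(1 + P) ^ card I * exp ((\<Sum>t\<in>I. (cmod (s t))\<^sup>2) / P)"
  have shift: "(\<lambda>z. \<lambda>t\<in>J. z t + s t) \<in> PiM J (\<lambda>_. borel) \<rightarrow>\<^sub>M PiM J (\<lambda>_. borel)" for J
    by measurable
  have "(\<integral>\<^sup>+z. F (\<lambda>t\<in>insert i I. z t + s t) \<partial>PiM (insert i I) (\<lambda>_. complex_gaussian)) =
      (\<integral>\<^sup>+x. \<integral>\<^sup>+y. F (\<lambda>t\<in>insert i I. (x(i := y)) t + s t) \<partial>complex_gaussian \<partial>PiM I (\<lambda>_. complex_gaussian))"
    using insert.hyps measurable_compose[OF shift insert.prems]
    by (subst G.product_nn_integral_insert) (auto cong: measurable_cong_sets simp: setsG)
  also have "\<dots> = (\<integral>\<^sup>+x. \<integral>\<^sup>+y. F ((\<lambda>t\<in>I. x t + s t)(i := y + s i)) \<partial>complex_gaussian \<partial>PiM I (\<lambda>_. complex_gaussian))"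
    using insert.hyps by (intro nn_integral_cong arg_cong[where f=F]) (auto simp: fun_eq_iff)
  \<comment> \<open>The law of coordinate \<open>i\<close> is exchanged with the others held fixed;
    the induction hypothesis is then applied to the integral that results.\<close>
  also have "\<dots> \<le> (\<integral>\<^sup>+x. ennreal (?c i) * (\<integral>\<^sup>+y. F ((\<lambda>t\<in>I. x t + s t)(i := y)) \<partial>complex_normal (1 + P)) \<partial>PiM I (\<lambda>_. complex_gaussian))"
    using assms(1) by (intro nn_integral_mono nn_integral_complex_gaussian_shift_le Fi) (auto simp: space_PiM)
  also have "\<dots> = ennreal (?c i) * (\<integral>\<^sup>+x. (\<integral>\<^sup>+y. F ((\<lambda>t\<in>I. x t + s t)(i := y)) \<partial>complex_normal (1 + P)) \<partial>PiM I (\<lambda>_. complex_gaussian))"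
    using measurable_compose[OF shift inner] by (intro nn_integral_cmult) (simp cong: measurable_cong_sets add: setsG)
  also have "\<dots> \<le> ennreal (?c i) * (ennreal ?C * (\<integral>\<^sup>+x. \<integral>\<^sup>+y. F (x(i := y)) \<partial>complex_normal (1 + P) \<partial>PiM I (\<lambda>_. complex_normal (1 + P))))"
    by (intro mult_left_mono insert.IH inner) simp
  also have "\<dots> = ennreal (?c i * ?C) * (\<integral>\<^sup>+z. F z \<partial>PiM (insert i I) (\<lambda>_. complex_normal (1 + P)))"
    using insert.hyps assms(1)
    by (subst N.product_nn_integral_insert) (auto simp: ennreal_mult mult.assoc setsN cong: measurable_cong_sets)
  also have "?c i * ?C = (1 + P) ^ card (insert i I) * exp ((\<Sum>t\<in>insert i I. (cmod (s t))\<^sup>2) / P)"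
    using insert.hyps by (simp add: exp_add add_divide_distrib)
  finally show ?case .
qed

text \<open>Tilting the standard density by this weight gives the density of variance 2, and each
  real coordinate contributes the factor \<open>sqrt 2\<close> to the mass.\<close>

lemma complex_gaussian_exp_moment:
  "(\<integral>\<^sup>+z. ennreal (exp ((cmod z)\<^sup>2 / 2)) \<partial>complex_gaussian) = 2"
proof -
  interpret N: prob_space "complex_normal 2"
    by (simp add: prob_space_complex_normal)
  define d e where "d = normal_density 0 (sqrt (1 / 2))" and "e = normal_density 0 (sqrt (2 / 2))"
  have d: "d x * exp (x\<^sup>2 / 2) = sqrt 2 * e x" for x
  proof -
    have "exp (- x\<^sup>2) * exp (x\<^sup>2 / 2) = exp (- x\<^sup>2 / 2)"
      unfolding exp_add[symmetric] by simp
    then show ?thesis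
      by (simp add: d_def e_def normal_density_def real_sqrt_mult field_simps)
  qed
  have "(\<integral>\<^sup>+z. ennreal (exp ((cmod z)\<^sup>2 / 2)) \<partial>complex_gaussian) =
      (\<integral>\<^sup>+x. \<integral>\<^sup>+y. ennreal (d x * d y) * ennreal (exp ((cmod (Complex x y))\<^sup>2 / 2)) \<partial>lborel \<partial>lborel)"
    unfolding complex_gaussian_eq_normal d_def by (subst nn_integral_complex_normal) auto
  also have "\<dots> = (\<integral>\<^sup>+x. \<integral>\<^sup>+y. ennreal (e x * e y) * 2 \<partial>lborel \<partial>lborel)"
  proof (intro nn_integral_cong)
    fix x y
    have "(d x * d y) * exp ((cmod (Complex x y))\<^sup>2 / 2) = (d x * exp (x\<^sup>2 / 2)) * (d y * exp (y\<^sup>2 / 2))"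
      by (simp add: cmod_power2 add_divide_distrib exp_add)
    also have "\<dots> = (e x * e y) * 2"
      unfolding d by simp
    finally show "ennreal (d x * d y) * ennreal (exp ((cmod (Complex x y))\<^sup>2 / 2)) = ennreal (e x * e y) * 2"
      by (simp add: ennreal_mult[symmetric] ennreal_mult'[symmetric] d_def e_def flip: ennreal_numeral)
  qed
  also have "\<dots> = (\<integral>\<^sup>+z. 2 \<partial>complex_normal 2)"
    unfolding e_def by (subst nn_integral_complex_normal) auto
  also have "\<dots> = 2"
    by (simp add: N.emeasure_space_1)
  finally show ?thesis .
qed

text \<open>Chernoff bound with exponent 1/2: the moment is 2 per letter and the threshold
  contributes \<open>exp (- 2)\<close> per letter, so the base is below 1.\<close>

lemma emeasure_PiM_complex_gaussian_energy_le:
  assumes "finite I"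
  shows "emeasure (PiM I (\<lambda>_. complex_gaussian))
      {z \<in> space (PiM I (\<lambda>_. complex_gaussian)). 4 * real (card I) \<le> (\<Sum>t\<in>I. (cmod (z t))\<^sup>2)}
    \<le> ennreal ((2 * exp (- 2)) ^ card I)"
proof -
  interpret G: product_sigma_finite "\<lambda>_ :: 'a. complex_gaussian"
    by (intro product_sigma_finite.intro prob_space_imp_sigma_finite prob_space_complex_gaussian)
  let ?M = "PiM I (\<lambda>_. complex_gaussian)"
  let ?u = "\<lambda>z. \<Prod>t\<in>I. ennreal (exp ((cmod (z t))\<^sup>2 / 2))"
  let ?c = "ennreal (exp (- 2 * real (card I)))"
  have u [measurable]: "?u \<in> borel_measurable ?M" by measurable
  have "{z \<in> space ?M. 4 * real (card I) \<le> (\<Sum>t\<in>I. (cmod (z t))\<^sup>2)} \<subseteq> {z \<in> space ?M. 1 \<le> ?c * ?u z}"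
  proof safe
    fix z :: "'a \<Rightarrow> complex" assume "4 * real (card I) \<le> (\<Sum>t\<in>I. (cmod (z t))\<^sup>2)"
    then have "0 \<le> - 2 * real (card I) + (\<Sum>t\<in>I. (cmod (z t))\<^sup>2 / 2)"
      by (simp add: sum_divide_distrib[symmetric])
    then have "1 \<le> exp (- 2 * real (card I) + (\<Sum>t\<in>I. (cmod (z t))\<^sup>2 / 2))"
      by simp
    also have "\<dots> = exp (- 2 * real (card I)) * (\<Prod>t\<in>I. exp ((cmod (z t))\<^sup>2 / 2))"
      using assms by (simp only: exp_add exp_sum)
    finally show "1 \<le> ?c * ?u z"
      by (simp add: prod_ennreal ennreal_mult[symmetric] prod_nonneg)
  qed
  then have "emeasure ?M {z \<in> space ?M. 4 * real (card I) \<le> (\<Sum>t\<in>I. (cmod (z t))\<^sup>2)}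
      \<le> emeasure ?M {z \<in> space ?M. 1 \<le> ?c * ?u z}"
    by (intro emeasure_mono) measurable
  also have "\<dots> \<le> ?c * (\<integral>\<^sup>+z. ?u z * indicator (space ?M) z \<partial>?M)"
    by (intro nn_integral_Markov_inequality) auto
  also have "(\<integral>\<^sup>+z. ?u z * indicator (space ?M) z \<partial>?M) = (\<integral>\<^sup>+z. ?u z \<partial>?M)"
    by (intro nn_integral_cong) simp
  also have "\<dots> = 2 ^ card I"
    using assms by (subst G.product_nn_integral_prod) (auto simp: complex_gaussian_exp_moment)
  also have "?c * 2 ^ card I = ennreal ((2 * exp (- 2)) ^ card I)"
    by (simp add: power_mult_distrib exp_of_nat_mult[symmetric] ennreal_mult' ennreal_power[symmetric]
       mult.commute)
  finally show ?thesis .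
qed

section \<open>Error probabilities as averages over the messages\<close>

lemma message_set_eq_PiE: "{w :: 'k \<Rightarrow> nat. \<forall>i. w i \<in> {1..M i}} = PiE UNIV (\<lambda>i. {1..M i})"
  by (auto simp: PiE_UNIV_domain)

lemma card_message_set:
  "card {w :: 'k::finite \<Rightarrow> nat. \<forall>i. w i \<in> {1..M i}} = (\<Prod>i\<in>UNIV. M i)"
  unfolding message_set_eq_PiE by (subst card_PiE) auto

lemma finite_message_set: "finite {w :: 'k::finite \<Rightarrow> nat. \<forall>i. w i \<in> {1..M i}}"
  unfolding message_set_eq_PiE by (intro finite_PiE) auto

lemma prob_space_noise: "prob_space (noise n)"
  unfolding noise_def by (intro prob_space_PiM prob_space_complex_gaussian)

lemma sets_PiM_complex_gaussian: "sets (PiM I (\<lambda>_. complex_gaussian)) = sets (PiM I (\<lambda>_. borel))"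
  by (intro sets_PiM_cong) auto

lemma space_PiM_complex_gaussian: "space (PiM I (\<lambda>_. complex_gaussian)) = space (PiM I (\<lambda>_. borel))"
  using sets_PiM_complex_gaussian by (rule sets_eq_imp_space_eq)

lemma measurable_noise_component:
  "(\<lambda>z. \<lambda>t\<in>{..<n}. z (j, t)) \<in> noise n \<rightarrow>\<^sub>M PiM {..<n} (\<lambda>_. complex_gaussian)"
  unfolding noise_def by measurable

text \<open>The marginal is the same for all receivers. In the converse this moves events at
  different receivers of a clique onto one common observation.\<close>

lemma distr_noise_component:
  "distr (noise n) (PiM {..<n} (\<lambda>_. complex_gaussian)) (\<lambda>z. \<lambda>t\<in>{..<n}. z (j, t))
     = PiM {..<n} (\<lambda>_. complex_gaussian)"
  unfolding noise_def
  by (rule distr_PiM_reindex) (auto simp: prob_space_complex_gaussian inj_on_def)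

lemma measure_noise_component:
  assumes "B \<in> sets (PiM {..<n} (\<lambda>_. complex_gaussian))"
  shows "measure (noise n) {z \<in> space (noise n). (\<lambda>t\<in>{..<n}. z (j, t)) \<in> B}
    = measure (PiM {..<n} (\<lambda>_. complex_gaussian)) B"
proof -
  have "measure (PiM {..<n} (\<lambda>_. complex_gaussian)) B =
      measure (distr (noise n) (PiM {..<n} (\<lambda>_. complex_gaussian)) (\<lambda>z. \<lambda>t\<in>{..<n}. z (j, t))) B"
    by (simp only: distr_noise_component)
  also have "\<dots> = measure (noise n) ((\<lambda>z. \<lambda>t\<in>{..<n}. z (j, t)) -` B \<inter> space (noise n))"
    using measurable_noise_component assms by (rule measure_distr)
  also have "(\<lambda>z. \<lambda>t\<in>{..<n}. z (j, t)) -` B \<inter> space (noise n) =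
      {z \<in> space (noise n). (\<lambda>t\<in>{..<n}. z (j, t)) \<in> B}"
    by auto
  finally show ?thesis by simp
qed

lemma measurable_received [measurable]:
  "(\<lambda>z. received T h n x z j) \<in> noise n \<rightarrow>\<^sub>M PiM {..<n} (\<lambda>_. borel)"
  unfolding received_def noise_def by measurable

text \<open>Induction along the decoding order. The passed messages form a random variable with
  countably many values, so decoding is a countable case distinction between the measurable maps
  \<open>g j _ m'\<close>.\<close>

lemma measurable_decoded:
  fixes T :: "'k::finite \<Rightarrow> 'k set"
  assumes order: "decoding_order prec"
    and g: "\<And>j m. (\<lambda>y. g j y m) \<in> PiM {..<n} (\<lambda>_. borel) \<rightarrow>\<^sub>M count_space UNIV"
  shows "(\<lambda>z. decoded prec g (received T h n x z) j) \<in> noise n \<rightarrow>\<^sub>M count_space UNIV"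
proof -
  have "wf prec"
    using order by (simp add: decoding_order_def acyclic_irrefl finite_acyclic_wf)
  then show ?thesis
  proof (induction j rule: wf_induct_rule)
    case (less j)
    define m where "m z = restrict (decoded prec g (received T h n x z)) {k. (k, j) \<in> prec}" for z
    have mk [measurable]: "(\<lambda>z. m z k) \<in> noise n \<rightarrow>\<^sub>M count_space UNIV" for k
      using less[of k] by (cases "(k, j) \<in> prec") (simp_all add: m_def)
    have meas: "m \<in> noise n \<rightarrow>\<^sub>M count_space UNIV"
    proof -
      have "m -` {m'} \<inter> space (noise n) = {z \<in> space (noise n). \<forall>k\<in>UNIV. m z k = m' k}" for m'
        by (auto intro: ext)
      also have "{z \<in> space (noise n). \<forall>k\<in>UNIV. m z k = m' k} \<in> sets (noise n)" for m'
        by measurable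
      finally show ?thesis
        by (simp add: measurable_count_space_eq_countable)
    qed
    have "(\<lambda>z. g j (received T h n x z j) m') \<in> noise n \<rightarrow>\<^sub>M count_space UNIV" for m'
      by (rule measurable_compose[OF measurable_received g])
    from measurable_compose_countable[where f="\<lambda>m' z. g j (received T h n x z j) m'", OF this meas]
    show ?case
      unfolding m_def decoded_eq[OF order, of g _ j, symmetric] .
  qed
qed

text \<open>The first factor is finite and uniform: events are finite unions of rectangles over
  single message tuples, and probabilities are averages over these tuples.\<close>

lemma prob_messages_noise:
  fixes M :: "'k::finite \<Rightarrow> nat" and \<Phi> :: "('k \<Rightarrow> nat) \<Rightarrow> ('k \<times> nat \<Rightarrow> complex) \<Rightarrow> bool"
  defines "W \<equiv> {w. \<forall>i. w i \<in> {1..M i}}"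
  assumes M: "\<And>i. 1 \<le> M i"
    and meas: "\<And>w. w \<in> W \<Longrightarrow> {z \<in> space (noise n). \<Phi> w z} \<in> sets (noise n)"
  shows "\<P>(\<omega> in messages M \<Otimes>\<^sub>M noise n. \<Phi> (fst \<omega>) (snd \<omega>))
           = (\<Sum>w\<in>W. measure (noise n) {z \<in> space (noise n). \<Phi> w z}) / card W"
    and "{\<omega> \<in> space (messages M \<Otimes>\<^sub>M noise n). \<Phi> (fst \<omega>) (snd \<omega>)} \<in> sets (messages M \<Otimes>\<^sub>M noise n)"
proof -
  interpret N: prob_space "noise n :: ('k \<times> nat \<Rightarrow> complex) measure" by (rule prob_space_noise)
  have "0 < M i" for i
    using M[of i] by simp
  then have W: "finite W" "card W > 0"
    unfolding W_def card_message_set using finite_message_set by (auto intro: prod_pos)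
  have sp: "space (messages M) = W" "sets (messages M) = Pow W"
    unfolding messages_def W_def by (simp_all add: space_uniform_count_measure sets_uniform_count_measure)
  let ?X = "{\<omega> \<in> space (messages M \<Otimes>\<^sub>M noise n). \<Phi> (fst \<omega>) (snd \<omega>)}"
  have "?X = (\<Union>w\<in>W. {w} \<times> {z \<in> space (noise n). \<Phi> w z})"
    by (auto simp: space_pair_measure sp)
  also have "\<dots> \<in> sets (messages M \<Otimes>\<^sub>M noise n)"
    using W meas by (intro sets.finite_UN pair_measureI) (auto simp: sp)
  finally show X: "?X \<in> sets (messages M \<Otimes>\<^sub>M noise n)" .
  have "emeasure (messages M \<Otimes>\<^sub>M noise n) ?X = (\<integral>\<^sup>+w. emeasure (noise n) (Pair w -` ?X) \<partial>messages M)"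
    using X by (rule N.emeasure_pair_measure_alt)
  also have "\<dots> = (\<integral>\<^sup>+w. emeasure (noise n) {z \<in> space (noise n). \<Phi> w z} \<partial>messages M)"
    by (intro nn_integral_cong arg_cong2[where f=emeasure]) (auto simp: space_pair_measure sp)
  also have "\<dots> = (\<Sum>w\<in>W. ennreal (1 / card W) * emeasure (noise n) {z \<in> space (noise n). \<Phi> w z})"
    using W unfolding messages_def uniform_count_measure_def W_def[symmetric]
    by (subst nn_integral_point_measure_finite) auto
  also have "\<dots> = (\<Sum>w\<in>W. ennreal (measure (noise n) {z \<in> space (noise n). \<Phi> w z} / card W))"
    by (intro sum.cong refl) (simp add: N.emeasure_eq_measure ennreal_mult[symmetric])
  also have "\<dots> = ennreal ((\<Sum>w\<in>W. measure (noise n) {z \<in> space (noise n). \<Phi> w z}) / card W)"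
    by (simp add: sum_divide_distrib)
  finally show "measure (messages M \<Otimes>\<^sub>M noise n) ?X
      = (\<Sum>w\<in>W. measure (noise n) {z \<in> space (noise n). \<Phi> w z}) / card W"
    by (intro measure_eq_emeasure_eq_ennreal) (auto simp: sum_nonneg)
qed

lemma error_prob_eq_average:
  fixes T :: "'k::finite \<Rightarrow> 'k set" and M :: "'k \<Rightarrow> nat"
  defines "W \<equiv> {w. \<forall>i. w i \<in> {1..M i}}"
  assumes order: "decoding_order prec" and M: "\<And>i. 1 \<le> M i"
    and g: "\<And>j m. (\<lambda>y. g j y m) \<in> PiM {..<n} (\<lambda>_. borel) \<rightarrow>\<^sub>M count_space UNIV"
  shows "error_prob T h prec n M f g j =
    (\<Sum>w\<in>W. measure (noise n)
       {z \<in> space (noise n). decoded prec g (received T h n (\<lambda>i. f i (w i)) z) j \<noteq> w j}) / card W"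
proof -
  have [measurable]: "(\<lambda>z. decoded prec g (received T h n x z) j) \<in> noise n \<rightarrow>\<^sub>M count_space UNIV" for x
    using order g by (rule measurable_decoded)
  show ?thesis
    unfolding error_prob_def W_def
    using prob_messages_noise(1)[of M n "\<lambda>w z. decoded prec g (received T h n (\<lambda>i. f i (w i)) z) j \<noteq> w j", OF M]
    by simp
qed

text \<open>Turns an average over one user's codebook, as in \<open>power_constraint\<close>, into
  an average over all message tuples. The proof writes \<open>\<phi> (w i)\<close> as a product over
  all users with factor 1 away from \<open>i\<close>.\<close>

lemma sum_message_set_component:
  fixes M :: "'k::finite \<Rightarrow> nat" and \<phi> :: "nat \<Rightarrow> real"
  defines "W \<equiv> {w :: 'k \<Rightarrow> nat. \<forall>i. w i \<in> {1..M i}}"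
  assumes "1 \<le> M i"
  shows "(\<Sum>w\<in>W. \<phi> (w i)) = card W * ((\<Sum>v\<in>{1..M i}. \<phi> v) / M i)"
proof -
  let ?f = "\<lambda>j v. if j = i then \<phi> v else 1"
  have "(\<Sum>w\<in>W. \<phi> (w i)) = (\<Sum>w\<in>PiE UNIV (\<lambda>i. {1..M i}). \<Prod>j\<in>UNIV. ?f j (w j))"
    unfolding W_def message_set_eq_PiE by (intro sum.cong refl) (simp add: prod.If_cases)
  also have "\<dots> = (\<Prod>j\<in>UNIV. \<Sum>v\<in>{1..M j}. ?f j v)"
    by (rule prod_sum_PiE[symmetric]) auto
  also have "\<dots> = (\<Sum>v\<in>{1..M i}. \<phi> v) * (\<Prod>j\<in>UNIV - {i}. real (M j))"
    by (subst prod.remove[of UNIV i]) auto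
  also have "(\<Prod>j\<in>UNIV - {i}. real (M j)) = card W / M i"
    unfolding W_def card_message_set using assms(2) by (subst prod.remove[of UNIV i M]) auto
  finally show ?thesis by simp
qed

section \<open>Rates on a clique\<close>

lemma cmod_sum_power2_le:
  "(cmod (\<Sum>i\<in>I. x i))\<^sup>2 \<le> card I * (\<Sum>i\<in>I. (cmod (x i))\<^sup>2)"
proof -
  have "(cmod (\<Sum>i\<in>I. x i))\<^sup>2 \<le> (\<Sum>i\<in>I. cmod (x i))\<^sup>2"
    by (intro power_mono norm_sum) simp
  also have "\<dots> \<le> card I * (\<Sum>i\<in>I. (cmod (x i))\<^sup>2)"
    using sum_squared_le_sum_of_squares[of "\<lambda>i. cmod (x i)" I] by (simp add: mult.commute)
  finally show ?thesis .
qed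

lemma measure_PiM_complex_gaussian_shift_le:
  assumes "0 < P" "finite I" and D: "D \<in> sets (PiM I (\<lambda>_. borel))"
  shows "measure (PiM I (\<lambda>_. complex_gaussian))
      {z \<in> space (PiM I (\<lambda>_. borel)). (\<lambda>t\<in>I. z t + s t) \<in> D}
    \<le> (1 + P) ^ card I * exp ((\<Sum>t\<in>I. (cmod (s t))\<^sup>2) / P) *
       measure (PiM I (\<lambda>_. complex_normal (1 + P))) D"
proof -
  let ?N = "PiM I (\<lambda>_. complex_gaussian)" and ?V = "PiM I (\<lambda>_. complex_normal (1 + P))"
  interpret N: prob_space ?N
    by (intro prob_space_PiM prob_space_complex_gaussian)
  interpret V: prob_space ?V
    using assms(1) by (intro prob_space_PiM prob_space_complex_normal) auto
  have setsV: "sets ?V = sets (PiM I (\<lambda>_. borel))"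
    by (intro sets_PiM_cong) auto
  let ?S = "{z \<in> space (PiM I (\<lambda>_. borel)). (\<lambda>t\<in>I. z t + s t) \<in> D}"
  have "(\<lambda>z. \<lambda>t\<in>I. z t + s t) \<in> PiM I (\<lambda>_. borel) \<rightarrow>\<^sub>M PiM I (\<lambda>_. borel)"
    by measurable
  from measurable_sets[OF this D] have S: "?S \<in> sets ?N"
    unfolding sets_PiM_complex_gaussian by (simp add: vimage_def Int_def conj_commute)
  have "ennreal (measure ?N ?S) = (\<integral>\<^sup>+z. indicator ?S z \<partial>?N)"
    using S by (simp add: N.emeasure_eq_measure)
  also have "\<dots> = (\<integral>\<^sup>+z. indicator D (\<lambda>t\<in>I. z t + s t) \<partial>?N)"
    by (intro nn_integral_cong) (auto simp: space_PiM_complex_gaussian indicator_def)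
  also have "\<dots> \<le> ennreal ((1 + P) ^ card I * exp ((\<Sum>t\<in>I. (cmod (s t))\<^sup>2) / P)) *
      (\<integral>\<^sup>+z. indicator D z \<partial>?V)"
    using assms by (intro nn_integral_PiM_complex_gaussian_shift_le) auto
  also have "\<dots> = ennreal ((1 + P) ^ card I * exp ((\<Sum>t\<in>I. (cmod (s t))\<^sup>2) / P) * measure ?V D)"
    using D assms(1) by (simp add: V.emeasure_eq_measure setsV ennreal_mult)
  finally show ?thesis
    using assms(1) by (subst (asm) ennreal_le_iff) auto
qed

text \<open>Markov's inequality for the uniform law. The power constraint holds on average only, and
  this selects at least half of the message tuples with controlled energy.\<close>

lemma card_le_twice_mean:
  fixes E :: "'a \<Rightarrow> real" and B :: real
  assumes "finite W" "\<And>w. w \<in> W \<Longrightarrow> 0 \<le> E w" "(\<Sum>w\<in>W. E w) \<le> card W * B" "0 < B"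
  shows "card W \<le> 2 * card {w \<in> W. E w \<le> 2 * B}"
proof -
  have "real (card {w \<in> W. \<not> E w \<le> 2 * B}) * (2 * B) = (\<Sum>w\<in>{w \<in> W. \<not> E w \<le> 2 * B}. 2 * B)"
    by simp
  also have "\<dots> \<le> (\<Sum>w\<in>{w \<in> W. \<not> E w \<le> 2 * B}. E w)"
    by (intro sum_mono) auto
  also have "\<dots> \<le> (\<Sum>w\<in>W. E w)"
    using assms by (intro sum_mono2) auto
  finally have "2 * real (card {w \<in> W. \<not> E w \<le> 2 * B}) * B \<le> card W * B"
    using assms(3) by (simp add: mult_ac)
  then have "2 * card {w \<in> W. \<not> E w \<le> 2 * B} \<le> card W"
    using \<open>0 < B\<close> by (simp flip: of_nat_le_iff)
  moreover have "card W = card {w \<in> W. E w \<le> 2 * B} + card {w \<in> W. \<not> E w \<le> 2 * B}"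
    using assms(1) by (subst card_Un_disjoint[symmetric]) (auto intro: arg_cong[where f=card])
  ultimately show ?thesis by simp
qed

lemma sum_energy_le:
  fixes M :: "'k::finite \<Rightarrow> nat"
  defines "W \<equiv> {w. \<forall>i. w i \<in> {1..M i}}"
  assumes pow: "power_constraint n P M f" and M: "\<And>i. 1 \<le> M i" and "0 < n"
  shows "(\<Sum>w\<in>W. \<Sum>t<n. (cmod (\<Sum>i\<in>Q. complex_of_real c * f i (w i) t))\<^sup>2)
    \<le> card W * (c\<^sup>2 * (real CARD('k))\<^sup>2 * n * P)"
proof -
  let ?e = "\<lambda>i v. \<Sum>t<n. (cmod (f i v t))\<^sup>2"
  have e: "(\<Sum>w\<in>W. ?e i (w i)) \<le> card W * (n * P)" for i
  proof -
    have "(\<Sum>v\<in>{1..M i}. ?e i v) / M i =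
        n * ((\<Sum>v\<in>{1..M i}. ?e i v / n) / M i)"
      using \<open>0 < n\<close> by (simp add: sum_divide_distrib[symmetric])
    also have "\<dots> \<le> n * P"
      using pow unfolding power_constraint_def by (intro mult_left_mono) auto
    finally have "(\<Sum>v\<in>{1..M i}. ?e i v) / M i \<le> n * P" .
    then have "card W * ((\<Sum>v\<in>{1..M i}. ?e i v) / M i) \<le> card W * (n * P)"
      by (rule mult_left_mono) simp
    then show ?thesis
      unfolding W_def sum_message_set_component[of M i "?e i", OF M] .
  qed
  have "0 \<le> (\<Sum>w\<in>W. ?e i (w i))" for i
    by (intro sum_nonneg) auto
  \<comment> \<open>The sign comes from the energies themselves, which are nonnegative and bounded
    by this quantity.\<close>
  from order_trans[OF this e] have nonneg: "0 \<le> card W * (n * P)" .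
  have card: "real (card Q) \<le> real CARD('k)"
    by (simp add: card_mono)
  have "(\<Sum>w\<in>W. \<Sum>t<n. (cmod (\<Sum>i\<in>Q. complex_of_real c * f i (w i) t))\<^sup>2)
      \<le> (\<Sum>w\<in>W. \<Sum>t<n. card Q * (\<Sum>i\<in>Q. c\<^sup>2 * (cmod (f i (w i) t))\<^sup>2))"
    by (intro sum_mono order_trans[OF cmod_sum_power2_le]) (simp add: norm_mult power_mult_distrib)
  also have "\<dots> = card Q * c\<^sup>2 * (\<Sum>w\<in>W. \<Sum>t<n. \<Sum>i\<in>Q. (cmod (f i (w i) t))\<^sup>2)"
    by (simp add: sum_distrib_left mult.assoc)
  also have "(\<Sum>w\<in>W. \<Sum>t<n. \<Sum>i\<in>Q. (cmod (f i (w i) t))\<^sup>2) = (\<Sum>i\<in>Q. \<Sum>w\<in>W. ?e i (w i))"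
    by (subst sum.swap[of _ Q "{..<n}"]) (rule sum.swap)
  also have "card Q * c\<^sup>2 * (\<Sum>i\<in>Q. \<Sum>w\<in>W. ?e i (w i)) \<le> card Q * c\<^sup>2 * (card Q * (card W * (n * P)))"
    using sum_mono[of Q "\<lambda>i. \<Sum>w\<in>W. ?e i (w i)" "\<lambda>_. card W * (n * P)"] e
    by (intro mult_left_mono) auto
  also have "\<dots> = (real (card Q))\<^sup>2 * (c\<^sup>2 * (card W * (n * P)))"
    by (simp add: power2_eq_square)
  also have "\<dots> \<le> (real CARD('k))\<^sup>2 * (c\<^sup>2 * (card W * (n * P)))"
    by (intro mult_right_mono power_mono card mult_nonneg_nonneg[OF _ nonneg]) auto
  finally show ?thesis by (simp add: mult_ac)
qed

text \<open>If nobody erred, the recursion would pass exactly the true messages to \<open>k\<close>.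
  So a decoder that fails even with true messages implies an actual error at some receiver, possibly
  another one.\<close>

lemma first_decoding_error:
  fixes prec :: "('k::finite \<times> 'k) set"
  assumes "decoding_order prec"
    and "g k (y k) (restrict w {i. (i, k) \<in> prec}) \<noteq> w k"
  shows "\<exists>j. decoded prec g y j \<noteq> w j"
proof (rule ccontr)
  assume "\<nexists>j. decoded prec g y j \<noteq> w j"
  then have "decoded prec g y = w" by auto
  then show False
    using decoded_eq[OF assms(1), of g y k] assms(2) by simp
qed

text \<open>All receivers of a clique see the sum of the clique's signals. After removal of the other
  signals, which are known to a genie, only the noise distinguishes their observations, and an
  error probability depends only on the distribution of that noise. So a single receiver
  recovers all messages of the clique one after the other, and its decoding regions are disjoint.\<close>

lemma clique_converse:
  fixes T :: "'k::finite \<Rightarrow> 'k set" and M :: "'k \<Rightarrow> nat" and c P :: real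
  assumes self: "\<And>j. j \<in> T j" and clique: "digraph_clique (conflict_digraph T) Q"
    and order: "decoding_order prec" and M: "\<And>i. 1 \<le> M i"
    and g: "\<And>j m. (\<lambda>y. g j y m) \<in> PiM {..<n} (\<lambda>_. borel) \<rightarrow>\<^sub>M count_space UNIV"
    and pow: "power_constraint n P M f" and pos: "0 < n" "0 < P" "0 < c"
    and err: "\<And>j. error_prob T (\<lambda>_ _ _. complex_of_real c) prec n M f g j \<le> \<epsilon>"
    and \<epsilon>: "4 * (real CARD('k))\<^sup>2 * \<epsilon> \<le> 1"
  shows "(\<Prod>i\<in>Q. real (M i)) \<le> 4 * ((1 + P) ^ n * exp (2 * c\<^sup>2 * (real CARD('k))\<^sup>2 * n))"
proof -
  define W where "W = {w :: 'k \<Rightarrow> nat. \<forall>i. w i \<in> {1..M i}}"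
  define K where "K = real CARD('k)"
  define N where "N = PiM {..<n} (\<lambda>_. complex_gaussian)"
  define V where "V = PiM {..<n} (\<lambda>_. complex_normal (1 + P))"
  define Y where "Y = PiM {..<n} (\<lambda>_. borel :: complex measure)"
  define s where "s w t = (\<Sum>i\<in>Q. complex_of_real c * f i (w i) t)" for w t
  define b where "b k w t = (\<Sum>i\<in>T k - Q. complex_of_real c * f i (w i) t)" for k w t
  \<comment> \<open>Here \<open>y\<close> models the clique's sum signal plus noise. Adding
    \<open>b k w\<close> restores the signals from outside \<open>Q\<close> at receiver
    \<open>k\<close>; it depends on \<open>w\<close> only outside \<open>Q\<close>, and this is what
    makes the regions disjoint below.\<close>
  define D where "D w = {y \<in> space Y. \<forall>k\<in>Q.
      g k (\<lambda>t\<in>{..<n}. y t + b k w t) (restrict w {i. (i, k) \<in> prec}) = w k}" for w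
  define rec where "rec w z = received T (\<lambda>_ _ _. complex_of_real c) n (\<lambda>i. f i (w i)) z" for w z
  have Mpos: "0 < M i" for i
    using M[of i] by simp
  have finW: "finite W" and cardW: "card W = (\<Prod>i\<in>UNIV. M i)"
    unfolding W_def by (rule finite_message_set, rule card_message_set)
  have cardW_pos: "0 < card W"
    unfolding cardW by (intro prod_pos) (simp add: Mpos)
  have QT: "Q \<subseteq> T k" if "k \<in> Q" for k
  proof
    fix i assume "i \<in> Q"
    then show "i \<in> T k"
      using clique self[of k] that unfolding digraph_clique_def conflict_digraph_def
      by (cases "i = k") auto
  qed
  interpret Z: prob_space "noise n :: ('k \<times> nat \<Rightarrow> complex) measure" by (rule prob_space_noise)
  interpret N: prob_space N
    unfolding N_def by (intro prob_space_PiM prob_space_complex_gaussian)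
  interpret V: prob_space V
    unfolding V_def using pos by (intro prob_space_PiM prob_space_complex_normal) auto
  have sets_N: "sets N = sets Y" and sets_V: "sets V = sets Y"
    unfolding N_def V_def Y_def by (auto intro!: sets_PiM_cong)
  have space_N: "space N = space Y"
    using sets_N by (rule sets_eq_imp_space_eq)
  have shift: "(\<lambda>y. \<lambda>t\<in>{..<n}. y t + a t) \<in> Y \<rightarrow>\<^sub>M Y" for a
    unfolding Y_def by measurable
  have g_shift: "(\<lambda>y. g k (\<lambda>t\<in>{..<n}. y t + a t) m) \<in> Y \<rightarrow>\<^sub>M count_space UNIV" for k a m
    using measurable_compose[OF shift, of _ "count_space UNIV"] g unfolding Y_def by blast
  have "D w = (\<Inter>k\<in>Q. {y \<in> space Y. g k (\<lambda>t\<in>{..<n}. y t + b k w t) (restrict w {i. (i, k) \<in> prec}) = w k})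
      \<inter> space Y" for w
    unfolding D_def by auto
  moreover have stage: "{y \<in> space Y. P (g k (\<lambda>t\<in>{..<n}. y t + a t) m)} \<in> sets Y" for k a m P
    using measurable_sets[OF g_shift, of "{v. P v}" k a m] by (simp add: vimage_def Int_def conj_commute)
  ultimately have D: "D w \<in> sets Y" for w
    by (cases "Q = {}") (auto intro!: sets.Int sets.finite_INT)

  \<comment> \<open>Union bound over the clique decoders. The failure of decoder \<open>k\<close>
    with true messages is an event of the noise at receiver \<open>k\<close>, whose law is
    \<open>N\<close>, and on the real channel it entails an error of some receiver
    \<open>j\<close>.\<close>
  have error_le: "measure N {y \<in> space Y. (\<lambda>t\<in>{..<n}. y t + s w t) \<notin> D w}
      \<le> K * (\<Sum>j\<in>UNIV. measure (noise n) {z \<in> space (noise n). decoded prec g (rec w z) j \<noteq> w j})" for w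
  proof -
    define B where "B k = {y \<in> space Y. g k (\<lambda>t\<in>{..<n}. y t + (s w t + b k w t))
        (restrict w {i. (i, k) \<in> prec}) \<noteq> w k}" for k
    have B: "B k \<in> sets N" for k
      unfolding B_def sets_N by (rule stage)
    have "{y \<in> space Y. (\<lambda>t\<in>{..<n}. y t + s w t) \<notin> D w} \<subseteq> (\<Union>k\<in>Q. B k)"
    proof
      fix y assume y: "y \<in> {y \<in> space Y. (\<lambda>t\<in>{..<n}. y t + s w t) \<notin> D w}"
      have "(\<lambda>t\<in>{..<n}. (\<lambda>t\<in>{..<n}. y t + s w t) t + b k w t) = (\<lambda>t\<in>{..<n}. y t + (s w t + b k w t))" for k
        by (auto simp: fun_eq_iff)
      then show "y \<in> (\<Union>k\<in>Q. B k)"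
        using y measurable_space[OF shift, of y "s w"] by (auto simp: D_def B_def)
    qed
    then have "measure N {y \<in> space Y. (\<lambda>t\<in>{..<n}. y t + s w t) \<notin> D w} \<le> measure N (\<Union>k\<in>Q. B k)"
      using B by (intro N.finite_measure_mono) auto
    also have "\<dots> \<le> (\<Sum>k\<in>Q. measure N (B k))"
      using B by (intro N.finite_measure_subadditive_finite) auto
    also have "\<dots> \<le> (\<Sum>k\<in>Q. \<Sum>j\<in>UNIV. measure (noise n) {z \<in> space (noise n). decoded prec g (rec w z) j \<noteq> w j})"
    proof (rule sum_mono)
      fix k assume k: "k \<in> Q"
      have E: "{z \<in> space (noise n). decoded prec g (rec w z) j \<noteq> w j} \<in> sets (noise n)" for j
        using measurable_sets[OF measurable_decoded[OF order g, where x="\<lambda>i. f i (w i)" and T=T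
              and h="\<lambda>_ _ _. complex_of_real c" and j=j], of "- {w j}"]
        by (simp add: vimage_def Int_def conj_commute rec_def)
      have rec_k: "rec w z k = (\<lambda>t\<in>{..<n}. (\<lambda>t\<in>{..<n}. z (k, t)) t + (s w t + b k w t))" for z
        using sum.subset_diff[OF QT[OF k], of "\<lambda>i. complex_of_real c * f i (w i) _"]
        by (auto simp: rec_def received_def s_def b_def fun_eq_iff)
      have "measure N (B k) = measure (noise n) {z \<in> space (noise n). (\<lambda>t\<in>{..<n}. z (k, t)) \<in> B k}"
        using measure_noise_component[of "B k" n k] B[of k] unfolding N_def by simp
      also have "\<dots> \<le> measure (noise n) (\<Union>j\<in>UNIV. {z \<in> space (noise n). decoded prec g (rec w z) j \<noteq> w j})"
      proof (rule Z.finite_measure_mono)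
        show "(\<Union>j\<in>UNIV. {z \<in> space (noise n). decoded prec g (rec w z) j \<noteq> w j}) \<in> sets (noise n)"
          using E by (intro sets.finite_UN) auto
        show "{z \<in> space (noise n). (\<lambda>t\<in>{..<n}. z (k, t)) \<in> B k}
            \<subseteq> (\<Union>j\<in>UNIV. {z \<in> space (noise n). decoded prec g (rec w z) j \<noteq> w j})"
        proof
          fix z assume z: "z \<in> {z \<in> space (noise n). (\<lambda>t\<in>{..<n}. z (k, t)) \<in> B k}"
          then have "g k (rec w z k) (restrict w {i. (i, k) \<in> prec}) \<noteq> w k"
            unfolding B_def rec_k by simp
          from first_decoding_error[of _ g k "rec w z", OF order this] z
          show "z \<in> (\<Union>j\<in>UNIV. {z \<in> space (noise n). decoded prec g (rec w z) j \<noteq> w j})"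
            by simp
        qed
      qed
      also have "\<dots> \<le> (\<Sum>j\<in>UNIV. measure (noise n) {z \<in> space (noise n). decoded prec g (rec w z) j \<noteq> w j})"
        using E by (intro Z.finite_measure_subadditive_finite) auto
      finally show "measure N (B k) \<le> \<dots>" .
    qed
    also have "\<dots> = card Q * (\<Sum>j\<in>UNIV. measure (noise n) {z \<in> space (noise n). decoded prec g (rec w z) j \<noteq> w j})"
      by simp
    also have "\<dots> \<le> K * (\<Sum>j\<in>UNIV. measure (noise n) {z \<in> space (noise n). decoded prec g (rec w z) j \<noteq> w j})"
      unfolding K_def by (intro mult_right_mono sum_nonneg) (auto simp: card_mono)
    finally show ?thesis .
  qed

  \<comment> \<open>One factor \<open>K\<close> stems from the clique decoders and one from the sum
    over \<open>j\<close>; the bound on \<open>\<epsilon>\<close> leaves a quarter of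
    \<open>card W\<close>.\<close>
  have total_error: "4 * (\<Sum>w\<in>W. measure N {y \<in> space Y. (\<lambda>t\<in>{..<n}. y t + s w t) \<notin> D w}) \<le> card W"
  proof -
    have "(\<Sum>w\<in>W. measure N {y \<in> space Y. (\<lambda>t\<in>{..<n}. y t + s w t) \<notin> D w})
        \<le> (\<Sum>w\<in>W. K * (\<Sum>j\<in>UNIV. measure (noise n) {z \<in> space (noise n). decoded prec g (rec w z) j \<noteq> w j}))"
      by (intro sum_mono error_le)
    also have "\<dots> = K * (\<Sum>j\<in>UNIV. \<Sum>w\<in>W. measure (noise n) {z \<in> space (noise n). decoded prec g (rec w z) j \<noteq> w j})"
      by (subst sum_distrib_left[symmetric]) (simp add: sum.swap[of _ W])
    also have "\<dots> = K * (\<Sum>j\<in>UNIV. card W * error_prob T (\<lambda>_ _ _. complex_of_real c) prec n M f g j)"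
      using cardW_pos unfolding error_prob_eq_average[OF order M g] rec_def W_def by simp
    also have "\<dots> \<le> K * (\<Sum>j\<in>(UNIV :: 'k set). card W * \<epsilon>)"
      unfolding K_def by (intro mult_left_mono sum_mono err) auto
    also have "\<dots> = card W * (K\<^sup>2 * \<epsilon>)"
      by (simp add: K_def power2_eq_square)
    finally have "4 * (\<Sum>w\<in>W. measure N {y \<in> space Y. (\<lambda>t\<in>{..<n}. y t + s w t) \<notin> D w})
        \<le> card W * (4 * K\<^sup>2 * \<epsilon>)"
      by simp
    also have "\<dots> \<le> card W"
      using \<epsilon> unfolding K_def by (intro mult_left_le) auto
    finally show ?thesis .
  qed

  define G where "G = {w \<in> W. (\<Sum>t<n. (cmod (s w t))\<^sup>2) \<le> 2 * (c\<^sup>2 * K\<^sup>2 * n * P)}"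
  have cardG: "card W \<le> 2 * card G"
    unfolding G_def
  proof (rule card_le_twice_mean[OF finW])
    show "(\<Sum>w\<in>W. \<Sum>t<n. (cmod (s w t))\<^sup>2) \<le> card W * (c\<^sup>2 * K\<^sup>2 * n * P)"
      using sum_energy_le[OF pow M pos(1), of c Q] unfolding s_def W_def K_def by simp
    show "0 < c\<^sup>2 * K\<^sup>2 * n * P"
      using pos unfolding K_def by simp
  qed (auto intro: sum_nonneg)
  let ?C = "(1 + P) ^ n * exp (2 * c\<^sup>2 * K\<^sup>2 * n)"
  have success_le: "1 - measure N {y \<in> space Y. (\<lambda>t\<in>{..<n}. y t + s w t) \<notin> D w} \<le> ?C * measure V (D w)"
    if "w \<in> G" for w
  proof -
    have S: "{y \<in> space Y. (\<lambda>t\<in>{..<n}. y t + s w t) \<in> D w} \<in> sets N"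
      using measurable_sets[OF shift D, of "s w" w] unfolding sets_N
      by (simp add: vimage_def Int_def conj_commute)
    have "{y \<in> space Y. (\<lambda>t\<in>{..<n}. y t + s w t) \<notin> D w} =
        space N - {y \<in> space Y. (\<lambda>t\<in>{..<n}. y t + s w t) \<in> D w}"
      by (auto simp: space_N)
    then have "1 - measure N {y \<in> space Y. (\<lambda>t\<in>{..<n}. y t + s w t) \<notin> D w} =
        measure N {y \<in> space Y. (\<lambda>t\<in>{..<n}. y t + s w t) \<in> D w}"
      using N.prob_compl[OF S] by simp
    also have "\<dots> \<le> (1 + P) ^ n * exp ((\<Sum>t<n. (cmod (s w t))\<^sup>2) / P) * measure V (D w)"
      using measure_PiM_complex_gaussian_shift_le[OF pos(2), of "{..<n}" "D w" "s w"] D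
      unfolding N_def V_def Y_def by simp
    \<comment> \<open>On \<open>G\<close> the energy is at most a constant times
      \<open>n * P\<close>, so \<open>P\<close> cancels in the exponent and the excess factor is
      only exponential in \<open>n\<close>.\<close>
    also have "\<dots> \<le> ?C * measure V (D w)"
      using that pos unfolding G_def
      by (intro mult_right_mono mult_left_mono) (auto simp: field_simps)
    finally show ?thesis .
  qed

  \<comment> \<open>Follow the decoding order: by induction both tuples pass the same messages to
    \<open>k\<close>, and the agreement outside \<open>Q\<close> gives both the same shifted
    observation, so decoder \<open>k\<close> can name only one value.\<close>
  have same_region: "w = w'"
    if w: "restrict w (- Q) = restrict w' (- Q)" and y: "y \<in> D w" "y \<in> D w'" for w w' y
  proof -
    have out: "w i = w' i" if "i \<notin> Q" for i
      using fun_cong[OF w, of i] that by simp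
    then have b_eq: "b k w = b k w'" for k
      by (auto simp: b_def fun_eq_iff)
    have "wf prec"
      using order by (simp add: decoding_order_def acyclic_irrefl finite_acyclic_wf)
    then have "w k = w' k" for k
    proof (induction k rule: wf_induct_rule)
      case (less k)
      then have "restrict w {i. (i, k) \<in> prec} = restrict w' {i. (i, k) \<in> prec}"
        by (auto simp: fun_eq_iff)
      then show ?case
        using y out[of k] b_eq[of k] unfolding D_def by (cases "k \<in> Q") force+
    qed
    then show ?thesis by auto
  qed

  \<comment> \<open>For a fixed assignment outside \<open>Q\<close> the regions are disjoint in a
    probability space, so they contribute at most 1; there remains one summand per
    assignment.\<close>
  have vol: "(\<Sum>w\<in>W. measure V (D w)) \<le> (\<Prod>i\<in>- Q. M i)"
  proof -
    let ?U = "PiE (- Q) (\<lambda>i. {1..M i})"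
    have "(\<Sum>w\<in>W. measure V (D w)) = (\<Sum>u\<in>?U. \<Sum>w\<in>{w \<in> W. restrict w (- Q) = u}. measure V (D w))"
      using finW by (intro sum.group[symmetric] finite_PiE) (auto simp: W_def)
    also have "\<dots> \<le> (\<Sum>u\<in>?U. 1)"
    proof (rule sum_mono)
      fix u
      have "(\<Sum>w\<in>{w \<in> W. restrict w (- Q) = u}. measure V (D w)) =
          measure V (\<Union>w\<in>{w \<in> W. restrict w (- Q) = u}. D w)"
        using finW D same_region
        by (intro V.finite_measure_finite_Union[symmetric]) (auto simp: sets_V disjoint_family_on_def)
      then show "(\<Sum>w\<in>{w \<in> W. restrict w (- Q) = u}. measure V (D w)) \<le> 1"
        by simp
    qed
    also have "\<dots> = (\<Prod>i\<in>- Q. M i)"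
      by (simp add: card_PiE)
    finally show ?thesis .
  qed
  have "real (card G) - (\<Sum>w\<in>W. measure N {y \<in> space Y. (\<lambda>t\<in>{..<n}. y t + s w t) \<notin> D w})
      \<le> ?C * (\<Sum>w\<in>W. measure V (D w))"
  proof -
    have GW: "G \<subseteq> W" unfolding G_def by auto
    have "real (card G) - (\<Sum>w\<in>W. measure N {y \<in> space Y. (\<lambda>t\<in>{..<n}. y t + s w t) \<notin> D w})
       \<le> real (card G) - (\<Sum>w\<in>G. measure N {y \<in> space Y. (\<lambda>t\<in>{..<n}. y t + s w t) \<notin> D w})"
      using finW GW by (intro diff_left_mono sum_mono2) auto
    also have "\<dots> = (\<Sum>w\<in>G. 1 - measure N {y \<in> space Y. (\<lambda>t\<in>{..<n}. y t + s w t) \<notin> D w})"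
      by (simp add: sum_subtractf)
    also have "\<dots> \<le> (\<Sum>w\<in>G. ?C * measure V (D w))"
      by (intro sum_mono success_le)
    also have "\<dots> \<le> (\<Sum>w\<in>W. ?C * measure V (D w))"
      using finW GW pos by (intro sum_mono2) auto
    finally show ?thesis by (simp add: sum_distrib_left)
  qed
  moreover have "?C * (\<Sum>w\<in>W. measure V (D w)) \<le> ?C * (\<Prod>i\<in>- Q. M i)"
    using pos by (intro mult_left_mono vol) auto
  moreover have "real (card W) \<le> 2 * real (card G)"
    using cardG by linarith
  \<comment> \<open>At least half of \<open>W\<close> lies in \<open>G\<close> and errors cost at
    most a quarter, so a quarter survives. This is the 4 in the claim.\<close>
  ultimately have "real (card W) \<le> 4 * (?C * (\<Prod>i\<in>- Q. M i))"
    using total_error by linarith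
  moreover have "card W = (\<Prod>i\<in>Q. M i) * (\<Prod>i\<in>- Q. M i)"
    unfolding cardW using prod.subset_diff[of Q UNIV M] by (simp add: Compl_eq_Diff_UNIV mult.commute)
  ultimately have "(\<Prod>i\<in>Q. real (M i)) * real (\<Prod>i\<in>- Q. M i) \<le> 4 * ?C * real (\<Prod>i\<in>- Q. M i)"
    by (simp only: of_nat_mult of_nat_prod mult.assoc)
  moreover have "0 < real (\<Prod>i\<in>- Q. M i)"
    unfolding of_nat_0_less_iff by (intro prod_pos) (simp add: Mpos)
  ultimately have "(\<Prod>i\<in>Q. real (M i)) \<le> 4 * ?C"
    by (rule mult_right_le_imp_le)
  then show ?thesis
    unfolding K_def .
qed

section \<open>From code sizes to rates on a clique\<close>

lemma num_messages_bounds: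
  assumes "0 \<le> R $ i"
  shows "1 \<le> num_messages n R i"
    and "real (num_messages n R i) \<le> 2 powr (real n * R $ i)"
    and "2 powr (real n * R $ i) \<le> 2 * real (num_messages n R i)"
proof -
  let ?x = "2 powr (real n * R $ i)"
  have x: "1 \<le> ?x"
    using assms by (simp add: ge_one_powr_ge_zero)
  have M: "real (num_messages n R i) = of_int \<lfloor>?x\<rfloor>"
    using x unfolding num_messages_def by simp
  \<comment> \<open>Rounding down a number that is at least 1 loses at most a factor 2, that is, one
    bit per user and block.\<close>
  have "1 \<le> \<lfloor>?x\<rfloor>"
    using x by simp
  then show "1 \<le> num_messages n R i" and "real (num_messages n R i) \<le> ?x"
    and "?x \<le> 2 * real (num_messages n R i)"
    using M x by linarith+
qed

text \<open>On the constant channel \<open>hmin\<close> the error eventually falls below the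
  tolerance of \<open>clique_converse\<close>. Taking logarithms and dividing by \<open>n\<close>,
  the factor 4 and the rounding losses leave \<open>(card Q + 2) / n\<close>, which
  vanishes.\<close>

lemma rate_region_clique_le:
  fixes T :: "'k::finite \<Rightarrow> 'k set"
  assumes self: "\<And>j. j \<in> T j" and h: "0 < hmin" "hmin \<le> hmax"
    and clique: "digraph_clique (conflict_digraph T) Q"
    and order: "decoding_order prec" and P: "0 < P"
    and R: "R \<in> rate_region hmin hmax T P prec"
  shows "(\<Sum>i\<in>Q. R $ i) \<le> log 2 (1 + P) + 2 * hmin\<^sup>2 * (real CARD('k))\<^sup>2 / ln 2"
proof -
  let ?K = "real CARD('k)" and ?M = "\<lambda>n. num_messages n R" and ?h = "\<lambda>_ _ _. complex_of_real hmin"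
  let ?L = "log 2 (1 + P) + 2 * hmin\<^sup>2 * ?K\<^sup>2 / ln 2"
  have R0: "0 \<le> R $ i" for i
    using R unfolding rate_region_def rate_region_active_def by blast
  obtain f :: "nat \<Rightarrow> 'k \<Rightarrow> nat \<Rightarrow> nat \<Rightarrow> complex"
    and g :: "nat \<Rightarrow> 'k channel \<Rightarrow> 'k \<Rightarrow> (nat \<Rightarrow> complex) \<Rightarrow> ('k \<Rightarrow> nat) \<Rightarrow> nat" where
    pow: "\<And>n. power_constraint n P (?M n) (f n)" and
    g: "\<And>n h j m. (\<lambda>y. g n h j y m) \<in> PiM {..<n} (\<lambda>_. borel) \<rightarrow>\<^sub>M count_space UNIV" and
    err: "\<And>h. h \<in> channels hmin hmax T \<Longrightarrow>
      (\<lambda>n. MAX j. error_prob T h prec n (?M n) (f n) (g n h) j) \<longlonglongrightarrow> 0"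
    using R unfolding rate_region_def rate_region_active_def by blast
  have "?h \<in> channels hmin hmax T"
    using h unfolding channels_def by auto
  moreover have "0 < 1 / (4 * ?K\<^sup>2)"
    by simp
  ultimately have "\<forall>\<^sub>F n in sequentially.
      (MAX j. error_prob T ?h prec n (?M n) (f n) (g n ?h) j) < 1 / (4 * ?K\<^sup>2)"
    using err order_tendstoD(2) by blast
  then have "\<forall>\<^sub>F n in sequentially. (\<Sum>i\<in>Q. R $ i) \<le> ?L + (card Q + 2) / n"
    using eventually_gt_at_top[of 0]
  proof eventually_elim
    case (elim n)
    have e1: "error_prob T ?h prec n (?M n) (f n) (g n ?h) j \<le> 1 / (4 * ?K\<^sup>2)" for j
      using elim(1) by (simp add: less_imp_le)
    have e2: "4 * ?K\<^sup>2 * (1 / (4 * ?K\<^sup>2)) \<le> 1"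
      by (simp add: divide_le_eq_1)
    have "(\<Prod>i\<in>Q. real (?M n i)) \<le> 4 * ((1 + P) ^ n * exp (2 * hmin\<^sup>2 * ?K\<^sup>2 * n))"
      using elim(2) h P by (intro clique_converse[OF self clique order num_messages_bounds(1)[OF R0] g pow _ _ _ e1 e2]) auto
    moreover have "2 powr (n * (\<Sum>i\<in>Q. R $ i)) = (\<Prod>i\<in>Q. 2 powr (n * R $ i))"
      by (simp add: powr_sum sum_distrib_left)
    moreover have "\<dots> \<le> (\<Prod>i\<in>Q. 2 * real (?M n i))"
      using num_messages_bounds(3)[OF R0] by (intro prod_mono) auto
    moreover have "\<dots> = 2 ^ card Q * (\<Prod>i\<in>Q. real (?M n i))"
      by (simp add: prod.distrib)
    ultimately have "2 powr (n * (\<Sum>i\<in>Q. R $ i))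
        \<le> 2 ^ card Q * (4 * ((1 + P) ^ n * exp (2 * hmin\<^sup>2 * ?K\<^sup>2 * n)))"
      by (smt (verit) mult_left_mono zero_le_power)
    also have "\<dots> = 2 powr (card Q + 2 + n * ?L)"
    proof -
      have "exp (2 * hmin\<^sup>2 * ?K\<^sup>2 * n) = 2 powr (n * (2 * hmin\<^sup>2 * ?K\<^sup>2 / ln 2))"
        by (simp add: powr_def)
      moreover have "(1 + P) ^ n = 2 powr (n * log 2 (1 + P))"
        using P by (simp add: mult.commute[of "real n"] powr_powr[symmetric] powr_realpow)
      moreover have "2 ^ card Q * 4 = 2 powr (card Q + 2)"
        by (simp add: powr_add powr_realpow)
      ultimately show ?thesis
        by (simp add: powr_add distrib_left mult.assoc)
    qed
    finally have "n * (\<Sum>i\<in>Q. R $ i) \<le> card Q + 2 + n * ?L"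
      by simp
    then show ?case
      using elim(2) by (simp add: field_simps)
  qed
  moreover have "(\<lambda>n. ?L + (card Q + 2) / n) \<longlonglongrightarrow> ?L + 0"
    by (intro tendsto_add tendsto_const lim_const_over_n)
  ultimately show ?thesis
    using tendsto_lowerbound[of "\<lambda>n. ?L + (card Q + 2) / n" ?L sequentially "\<Sum>i\<in>Q. R $ i"] by simp
qed

text \<open>The bound is the same for all decoding orders and describes a half-space, so it survives
  time sharing.\<close>

lemma capacity_region_clique_le:
  fixes T :: "'k::finite \<Rightarrow> 'k set"
  assumes "\<And>j. j \<in> T j" "0 < hmin" "hmin \<le> hmax"
    and "digraph_clique (conflict_digraph T) Q" "0 < P"
    and "R \<in> capacity_region hmin hmax T P"
  shows "(\<Sum>i\<in>Q. R $ i) \<le> log 2 (1 + P) + 2 * hmin\<^sup>2 * (real CARD('k))\<^sup>2 / ln 2"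
proof -
  let ?L = "log 2 (1 + P) + 2 * hmin\<^sup>2 * (real CARD('k))\<^sup>2 / ln 2"
  have "convex {R. (\<Sum>i\<in>Q. R $ i) \<le> ?L}"
    unfolding convex_def
    by (auto simp: sum.distrib sum_distrib_left[symmetric] intro!: convex_bound_le)
  moreover have "(\<Union>prec \<in> {prec. decoding_order prec}. rate_region hmin hmax T P prec)
      \<subseteq> {R. (\<Sum>i\<in>Q. R $ i) \<le> ?L}"
    using rate_region_clique_le[OF assms(1-4) _ assms(5)] by blast
  ultimately show ?thesis
    using assms(6) hull_minimal unfolding capacity_region_def by blast
qed

lemma capacity_region_nonneg:
  assumes "R \<in> capacity_region hmin hmax T P"
  shows "0 \<le> R $ i"
proof -
  have "convex {R :: real ^ 'a. 0 \<le> R $ i}"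
    unfolding convex_def by auto
  moreover have "(\<Union>prec \<in> {prec. decoding_order prec}. rate_region hmin hmax T P prec) \<subseteq> {R. 0 \<le> R $ i}"
    unfolding rate_region_def rate_region_active_def by auto
  ultimately show ?thesis
    using assms hull_minimal unfolding capacity_region_def by blast
qed

section \<open>Upper bound on the degrees of freedom\<close>

lemma filterlim_log2_at_top:
  assumes "filterlim P at_top F"
  shows "filterlim (\<lambda>m. log 2 (P m)) at_top F"
proof -
  have "filterlim (\<lambda>m. 1 / ln 2 * ln (P m)) at_top F"
    using filterlim_compose[OF ln_at_top assms]
    by (intro filterlim_tendsto_pos_mult_at_top[OF tendsto_const]) auto
  then show ?thesis
    by (simp add: log_def)
qed

lemma dof_region_subset:
  fixes T :: "'k::finite \<Rightarrow> 'k set"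
  assumes "\<And>j. j \<in> T j" "0 < hmin" "hmin \<le> hmax"
  shows "dof_region hmin hmax T \<subseteq> set_packing_polytope (symmetric_part (conflict_digraph T))"
proof
  fix d assume "d \<in> dof_region hmin hmax T"
  then obtain P :: "nat \<Rightarrow> real" and R :: "nat \<Rightarrow> real ^ 'k" where
    P: "filterlim P at_top sequentially" and R: "\<And>m. R m \<in> capacity_region hmin hmax T (P m)" and
    lim: "\<And>i. (\<lambda>m. R m $ i / log 2 (P m)) \<longlonglongrightarrow> d $ i"
    unfolding dof_region_def dof_tuples_def by auto
  have P1: "\<forall>\<^sub>F m in sequentially. 1 < P m"
    using P by (simp add: filterlim_at_top_dense)
  have "0 \<le> d $ i" for i
    using P1 capacity_region_nonneg[OF R]
    by (intro tendsto_lowerbound[OF lim]) (auto elim!: eventually_mono)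
  moreover have le: "(\<Sum>i\<in>Q. d $ i) \<le> 1" if Q: "digraph_clique (conflict_digraph T) Q" for Q
  proof -
    \<comment> \<open>The summand 1 pays for
      \<open>log 2 (1 + P m) \<le> 1 + log 2 (P m)\<close>.\<close>
    let ?B = "1 + 2 * hmin\<^sup>2 * (real CARD('k))\<^sup>2 / ln 2"
    have "(\<lambda>m. 1 + ?B / log 2 (P m)) \<longlonglongrightarrow> 1 + 0"
      using filterlim_log2_at_top[OF P]
      by (intro tendsto_add tendsto_const tendsto_divide_0[OF tendsto_const] filterlim_at_top_imp_at_infinity)
    moreover have "(\<lambda>m. \<Sum>i\<in>Q. R m $ i / log 2 (P m)) \<longlonglongrightarrow> (\<Sum>i\<in>Q. d $ i)"
      by (intro tendsto_sum lim)
    moreover have "\<forall>\<^sub>F m in sequentially. (\<Sum>i\<in>Q. R m $ i / log 2 (P m)) \<le> 1 + ?B / log 2 (P m)"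
      using P1
    proof eventually_elim
      case (elim m)
      have "log 2 (1 + P m) \<le> log 2 (2 * P m)"
        using elim by simp
      also have "\<dots> = 1 + log 2 (P m)"
        using elim by (simp add: log_mult)
      finally have "(\<Sum>i\<in>Q. R m $ i) \<le> log 2 (P m) + ?B"
        using capacity_region_clique_le[OF assms Q _ R[of m]] elim by simp
      moreover have "0 < log 2 (P m)"
        using elim by simp
      ultimately show ?case
        by (simp add: sum_divide_distrib[symmetric] field_simps)
    qed
    ultimately show ?thesis
      using tendsto_le[OF sequentially_bot] by fastforce
  qed
  moreover have "d $ k \<le> 1" for k
    using le[of "{k}"] by (simp add: digraph_clique_def)
  ultimately show "d \<in> set_packing_polytope (symmetric_part (conflict_digraph T))"
    unfolding set_packing_polytope_def maximal_sets_def graph_clique_symmetric_part by auto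
qed

section \<open>Packings in a quadrature grid\<close>

text \<open>Gilbert--Varshamov: the balls around the points of a maximal packing cover.\<close>

lemma ex_packing:
  fixes X :: "'a set" and B :: real
  assumes "finite X" and sym: "\<And>x y. near x y \<Longrightarrow> near y x" and refl: "\<And>x. near x x"
    and ball: "\<And>x. x \<in> X \<Longrightarrow> real (card {y \<in> X. near x y}) \<le> B"
  obtains C where "C \<subseteq> X" "pairwise (\<lambda>x y. \<not> near x y) C" "real (card X) \<le> card C * B"
proof -
  define F where "F = {C. C \<subseteq> X \<and> pairwise (\<lambda>x y. \<not> near x y) C}"
  have "finite F" "{} \<in> F"
    using assms(1) unfolding F_def by simp_all
  from finite_has_maximal2[OF this] obtain C where CF: "C \<in> F" "\<forall>C'\<in>F. C \<subseteq> C' \<longrightarrow> C = C'"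
    by blast
  then have C: "C \<subseteq> X" "pairwise (\<lambda>x y. \<not> near x y) C"
    unfolding F_def by auto
  have "X \<subseteq> (\<Union>c\<in>C. {y \<in> X. near c y})"
  proof
    fix x assume x: "x \<in> X"
    show "x \<in> (\<Union>c\<in>C. {y \<in> X. near c y})"
    proof (rule ccontr)
      assume "x \<notin> (\<Union>c\<in>C. {y \<in> X. near c y})"
      then have far: "\<not> near c x" if "c \<in> C" for c
        using x that by auto
      then have "pairwise (\<lambda>x y. \<not> near x y) (insert x C)"
        using C(2) sym by (auto simp: pairwise_insert)
      then have "x \<in> C"
        using CF(2) C(1) x unfolding F_def by blast
      then show False
        using far refl by blast
    qed
  qed
  moreover have finC: "finite C"
    using C(1) assms(1) by (rule finite_subset)
  ultimately have "card X \<le> card (\<Union>c\<in>C. {y \<in> X. near c y})"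
    using assms(1) by (intro card_mono) auto
  also have "\<dots> \<le> (\<Sum>c\<in>C. card {y \<in> X. near c y})"
    using finC by (rule card_UN_le)
  finally have "real (card X) \<le> (\<Sum>c\<in>C. real (card {y \<in> X. near c y}))"
    by (simp flip: of_nat_sum)
  also have "\<dots> \<le> (\<Sum>c\<in>C. B)"
    using C(1) ball by (intro sum_mono) auto
  finally show ?thesis
    using that[OF C] by simp
qed

text \<open>A two-sided geometric series: at most 2 from the points up to \<open>a\<close> and at
  most 1 from those above, uniformly in \<open>q\<close>.\<close>

lemma sum_half_power_dist_le: "(\<Sum>c<q. (1 / 2) ^ nat \<bar>int a - int c\<bar>) \<le> (3 :: real)"
proof -
  have below: "(\<Sum>c\<le>a. (1 / 2) ^ (a - c)) \<le> (2 :: real)" for a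
  proof (induction a)
    case (Suc a)
    have "(\<Sum>c\<le>a. (1 / 2) ^ (Suc a - c)) = (1 / 2 :: real) * (\<Sum>c\<le>a. (1 / 2) ^ (a - c))"
      by (simp add: sum_distrib_left Suc_diff_le)
    then show ?case
      using Suc.IH by simp
  qed simp
  have above: "(\<Sum>k<q. (1 / 2) ^ Suc k) \<le> (1 :: real)" for q
  proof -
    have "(\<Sum>k<q. (1 / 2) ^ Suc k) = 1 - (1 / 2 :: real) ^ q"
      by (induction q) auto
    then show ?thesis by simp
  qed
  have "(\<Sum>c<q. (1 / 2) ^ nat \<bar>int a - int c\<bar>) \<le> (\<Sum>c\<in>{..a} \<union> (\<lambda>k. a + Suc k) ` {..<q}. (1 / 2 :: real) ^ nat \<bar>int a - int c\<bar>)"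
  proof (rule sum_mono2)
    show "{..<q} \<subseteq> {..a} \<union> (\<lambda>k. a + Suc k) ` {..<q}"
    proof
      fix c assume "c \<in> {..<q}"
      then show "c \<in> {..a} \<union> (\<lambda>k. a + Suc k) ` {..<q}"
        using image_eqI[of c "\<lambda>k. a + Suc k" "c - Suc a" "{..<q}"] by (cases "c \<le> a") auto
    qed
  qed auto
  also have "\<dots> = (\<Sum>c\<le>a. (1 / 2) ^ nat \<bar>int a - int c\<bar>) + (\<Sum>c\<in>(\<lambda>k. a + Suc k) ` {..<q}. (1 / 2) ^ nat \<bar>int a - int c\<bar>)"
    by (rule sum.union_disjoint) auto
  also have "(\<Sum>c\<le>a. (1 / 2 :: real) ^ nat \<bar>int a - int c\<bar>) = (\<Sum>c\<le>a. (1 / 2) ^ (a - c))"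
    by (intro sum.cong refl arg_cong2[where f="(^)"]) auto
  also have "(\<Sum>c\<in>(\<lambda>k. a + Suc k) ` {..<q}. (1 / 2 :: real) ^ nat \<bar>int a - int c\<bar>) = (\<Sum>k<q. (1 / 2) ^ Suc k)"
    by (subst sum.reindex) (auto intro!: sum.cong simp: inj_on_def nat_add_distrib)
  finally show ?thesis
    using below[of a] above[of q] by linarith
qed

text \<open>An integer grid with its corner at the origin. Not centring it costs a constant factor
  of power, invisible in the degrees of freedom.\<close>

definition qam :: "nat \<Rightarrow> complex set" where
  "qam q = (\<lambda>(a, b). Complex (real a) (real b)) ` ({..<q} \<times> {..<q})"

lemma inj_on_qam: "inj_on (\<lambda>(a, b). Complex (real a) (real b)) S"
  by (auto simp: inj_on_def)

lemma card_qam: "card (qam q) = q\<^sup>2"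
  unfolding qam_def by (subst card_image[OF inj_on_qam]) (simp add: power2_eq_square)

lemma finite_qam: "finite (qam q)"
  unfolding qam_def by simp

lemma qam_energy:
  assumes "x \<in> qam q"
  shows "(cmod x)\<^sup>2 \<le> 2 * (real q)\<^sup>2"
proof -
  obtain a b where ab: "x = Complex (real a) (real b)" "a < q" "b < q"
    using assms unfolding qam_def by auto
  have "(real a)\<^sup>2 \<le> (real q)\<^sup>2" "(real b)\<^sup>2 \<le> (real q)\<^sup>2"
    using ab by (auto intro!: power_mono)
  then show ?thesis
    unfolding ab(1) cmod_power2 complex.sel by linarith
qed

text \<open>The weight factors over real and imaginary part, and
  \<open>\<bar>m\<bar> \<le> m^2\<close> for integers compares each factor with a geometric series.
  The bound 9 = 3 * 3 does not grow with \<open>q\<close>, so the packing loss stays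
  constant.\<close>

lemma qam_distance_enumerator:
  assumes "x \<in> qam q"
  shows "(\<Sum>y\<in>qam q. 2 powr - (cmod (x - y))\<^sup>2) \<le> 9"
proof -
  obtain a b where ab: "x = Complex (real a) (real b)"
    using assms unfolding qam_def by auto
  let ?d = "\<lambda>a c. (1 / 2 :: real) ^ nat \<bar>int a - int c\<bar>"
  have d: "2 powr - (real a - real c)\<^sup>2 \<le> ?d a c" for a c
  proof -
    have "\<bar>int a - int c\<bar> \<le> (int a - int c)\<^sup>2"
      using self_le_power[of "\<bar>int a - int c\<bar>" 2] by (cases "a = c") auto
    then have "real_of_int \<bar>int a - int c\<bar> \<le> real_of_int ((int a - int c)\<^sup>2)"
      by (simp only: of_int_le_iff)
    then have "real (nat \<bar>int a - int c\<bar>) \<le> (real a - real c)\<^sup>2"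
      by simp
    then have "2 powr - (real a - real c)\<^sup>2 \<le> 2 powr - real (nat \<bar>int a - int c\<bar>)"
      by simp
    also have "2 powr - real k = (1 / 2) ^ k" for k
      by (simp add: powr_minus powr_realpow power_one_over inverse_eq_divide)
    finally show ?thesis .
  qed
  have "(\<Sum>y\<in>qam q. 2 powr - (cmod (x - y))\<^sup>2) =
      (\<Sum>c<q. \<Sum>e<q. 2 powr - (real a - real c)\<^sup>2 * 2 powr - (real b - real e)\<^sup>2)"
    unfolding qam_def ab
    by (subst sum.reindex[OF inj_on_qam])
      (auto simp: sum.cartesian_product cmod_power2 powr_add[symmetric] intro!: sum.cong)
  also have "\<dots> \<le> (\<Sum>c<q. \<Sum>e<q. ?d a c * ?d b e)"
    by (intro sum_mono mult_mono d) auto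
  also have "\<dots> = (\<Sum>c<q. ?d a c) * (\<Sum>e<q. ?d b e)"
    by (rule sum_product[symmetric])
  also have "\<dots> \<le> 3 * 3"
    by (intro mult_mono sum_half_power_dist_le sum_nonneg) auto
  finally show ?thesis by simp
qed

text \<open>Weighing the words of a ball by \<open>2 powr - (squared distance)\<close> makes the count factor over
  the letters.\<close>

lemma qam_ball_card:
  assumes x: "x \<in> PiE {..<n} (\<lambda>_. qam q)"
  shows "real (card {y \<in> PiE {..<n} (\<lambda>_. qam q). (\<Sum>t<n. (cmod (x t - y t))\<^sup>2) \<le> r * n})
    \<le> (9 * 2 powr r) ^ n"
proof -
  let ?X = "PiE {..<n} (\<lambda>_. qam q)"
  let ?D = "\<lambda>y. \<Sum>t<n. (cmod (x t - y t))\<^sup>2"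
  have fin: "finite ?X"
    by (intro finite_PiE) (auto simp: finite_qam)
  have "real (card {y \<in> ?X. ?D y \<le> r * n}) = (\<Sum>y\<in>{y \<in> ?X. ?D y \<le> r * n}. 1)"
    by simp
  also have "\<dots> \<le> (\<Sum>y\<in>{y \<in> ?X. ?D y \<le> r * n}. 2 powr (r * n) * 2 powr - ?D y)"
  proof (rule sum_mono)
    fix y assume "y \<in> {y \<in> ?X. ?D y \<le> r * n}"
    then have "1 \<le> 2 powr (r * n + - ?D y)"
      by (intro ge_one_powr_ge_zero) simp_all
    then show "1 \<le> 2 powr (r * n) * 2 powr - ?D y"
      by (simp only: powr_add)
  qed
  also have "\<dots> \<le> (\<Sum>y\<in>?X. 2 powr (r * n) * 2 powr - ?D y)"
    using fin by (intro sum_mono2) auto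
  also have "\<dots> = 2 powr (r * n) * (\<Sum>y\<in>?X. \<Prod>t<n. 2 powr - (cmod (x t - y t))\<^sup>2)"
    by (simp add: sum_distrib_left powr_sum[symmetric] sum_negf)
  also have "\<dots> = 2 powr (r * n) * (\<Prod>t<n. \<Sum>y\<in>qam q. 2 powr - (cmod (x t - y))\<^sup>2)"
    by (subst prod_sum_PiE) (auto simp: finite_qam)
  also have "\<dots> \<le> 2 powr (r * n) * (\<Prod>t<n. 9)"
    using x by (intro mult_left_mono prod_mono conjI sum_nonneg qam_distance_enumerator) auto
  also have "\<dots> = (9 * 2 powr r) ^ n"
    by (simp add: power_mult_distrib powr_realpow[symmetric] powr_powr)
  finally show ?thesis .
qed

text \<open>There are \<open>q^(2 * n)\<close> words and every ball has at most
  \<open>(9 * 2 powr r) ^ n\<close> of them, so a packing of at least the quotient exists. The loss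
  per letter does not depend on \<open>q\<close>.\<close>

lemma ex_qam_code:
  assumes r: "0 \<le> r" and M: "real M * (9 * 2 powr r) ^ n \<le> ((real q)\<^sup>2) ^ n"
  obtains x :: "nat \<Rightarrow> nat \<Rightarrow> complex" where
    "\<And>w t. w \<in> {1..M} \<Longrightarrow> t < n \<Longrightarrow> x w t \<in> qam q"
    "\<And>w w'. w \<in> {1..M} \<Longrightarrow> w' \<in> {1..M} \<Longrightarrow> w \<noteq> w' \<Longrightarrow> r * n < (\<Sum>t<n. (cmod (x w t - x w' t))\<^sup>2)"
proof -
  let ?X = "PiE {..<n} (\<lambda>_. qam q)"
  define near where "near x y \<longleftrightarrow> (\<Sum>t<n. (cmod (x t - y t))\<^sup>2) \<le> r * n" for x y :: "nat \<Rightarrow> complex"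
  have fin: "finite ?X"
    by (intro finite_PiE) (auto simp: finite_qam)
  obtain C where C: "C \<subseteq> ?X" "pairwise (\<lambda>x y. \<not> near x y) C"
    and card: "real (card ?X) \<le> card C * (9 * 2 powr r) ^ n"
  proof (rule ex_packing[of ?X near "(9 * 2 powr r) ^ n"])
    show "near y x" if "near x y" for x y
      using that unfolding near_def by (simp add: norm_minus_commute)
    show "near x x" for x
      using r unfolding near_def by simp
    show "real (card {y \<in> ?X. near x y}) \<le> (9 * 2 powr r) ^ n" if "x \<in> ?X" for x
      using qam_ball_card[OF that] unfolding near_def .
  qed (use fin in auto)
  have "real (card ?X) = ((real q)\<^sup>2) ^ n"
    by (subst card_PiE) (auto simp: card_qam)
  then have "real M * (9 * 2 powr r) ^ n \<le> real (card C) * (9 * 2 powr r) ^ n"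
    using M card by linarith
  then have "M \<le> card C"
    by (subst (asm) mult_le_cancel_right_pos) auto
  moreover have "finite C"
    using C(1) fin by (rule finite_subset)
  \<comment> \<open>The enumeration starts at 1 because messages do.\<close>
  ultimately obtain x where x: "bij_betw x {1..card C} C"
    using ex_bij_betw_nat_finite_1 by blast
  show ?thesis
  proof (rule that[of x])
    fix w t assume "w \<in> {1..M}" "t < n"
    then have "x w \<in> C"
      using x \<open>M \<le> card C\<close> by (auto simp: bij_betw_def)
    then show "x w t \<in> qam q"
      using C(1) \<open>t < n\<close> by auto
  next
    fix w w' assume w: "w \<in> {1..M}" "w' \<in> {1..M}" "w \<noteq> w'"
    then have "w \<in> {1..card C}" "w' \<in> {1..card C}"
      using \<open>M \<le> card C\<close> by auto
    then have "x w \<in> C" "x w' \<in> C" "x w \<noteq> x w'"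
      using x w(3) by (auto simp: bij_betw_def inj_on_eq_iff)
    then show "r * n < (\<Sum>t<n. (cmod (x w t - x w' t))\<^sup>2)"
      using C(2) unfolding pairwise_def near_def by fastforce
  qed
qed

section \<open>Successive decoding of an acyclic set\<close>

text \<open>If two words were both within the noise radius of the observation, the triangle inequality
  would put their images under the channel closer together than the code allows.\<close>

lemma threshold_decoding_unique:
  fixes h x x' z :: "nat \<Rightarrow> complex"
  assumes h: "\<And>t. t < n \<Longrightarrow> hmin \<le> cmod (h t)" and "0 < hmin"
    and far: "16 / hmin\<^sup>2 * real n < (\<Sum>t<n. (cmod (x t - x' t))\<^sup>2)"
    and z: "(\<Sum>t<n. (cmod (z t))\<^sup>2) \<le> 4 * real n"
  shows "4 * real n < (\<Sum>t<n. (cmod (h t * x t + z t - h t * x' t))\<^sup>2)"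
proof (rule ccontr)
  assume "\<not> 4 * real n < (\<Sum>t<n. (cmod (h t * x t + z t - h t * x' t))\<^sup>2)"
  then have close: "(\<Sum>t<n. (cmod (h t * x t + z t - h t * x' t))\<^sup>2) \<le> 4 * real n" by simp
  \<comment> \<open>Two energies of at most \<open>4 * n\<close> combine through
    \<open>(a + b)^2 \<le> 2 * a^2 + 2 * b^2\<close> to \<open>16 * n\<close>; hence the constant in
    the distance.\<close>
  have "16 * real n < hmin\<^sup>2 * (\<Sum>t<n. (cmod (x t - x' t))\<^sup>2)"
    using far \<open>0 < hmin\<close> by (simp add: field_simps)
  also have "\<dots> \<le> (\<Sum>t<n. (cmod (h t * (x t - x' t)))\<^sup>2)"
    unfolding sum_distrib_left norm_mult power_mult_distrib
    using h \<open>0 < hmin\<close> by (intro sum_mono mult_right_mono power_mono) auto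
  also have "\<dots> \<le> (\<Sum>t<n. 2 * (cmod (h t * x t + z t - h t * x' t))\<^sup>2 + 2 * (cmod (z t))\<^sup>2)"
  proof (rule sum_mono)
    fix t
    let ?a = "h t * x t + z t - h t * x' t"
    have "cmod (h t * (x t - x' t)) = cmod (?a - z t)"
      by (simp add: algebra_simps)
    also have "\<dots> \<le> cmod ?a + cmod (z t)"
      by (rule norm_triangle_ineq4)
    finally have "(cmod (h t * (x t - x' t)))\<^sup>2 \<le> (cmod ?a + cmod (z t))\<^sup>2"
      by (rule power_mono) simp
    also have "\<dots> \<le> 2 * (cmod ?a)\<^sup>2 + 2 * (cmod (z t))\<^sup>2"
      using sum_squares_bound[of "cmod ?a" "cmod (z t)"] by (simp add: power2_sum)
    finally show "(cmod (h t * (x t - x' t)))\<^sup>2 \<le> 2 * (cmod ?a)\<^sup>2 + 2 * (cmod (z t))\<^sup>2" .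
  qed
  also have "\<dots> = 2 * (\<Sum>t<n. (cmod (h t * x t + z t - h t * x' t))\<^sup>2) + 2 * (\<Sum>t<n. (cmod (z t))\<^sup>2)"
    by (simp add: sum.distrib sum_distrib_left)
  also have "\<dots> \<le> 16 * real n"
    using close z by simp
  finally show False by simp
qed

text \<open>\<open>LEAST\<close> makes the choice deterministic and is harmless once the candidate
  is unique. The cancelled sum runs over all interferers, including those whose message was not
  passed: inactive users send 0 whatever \<open>m i\<close> is. Inactive users have the single
  message 1, hence the default.\<close>

definition successive_decoder ::
    "('k \<Rightarrow> 'k set) \<Rightarrow> 'k set \<Rightarrow> ('k \<Rightarrow> nat) \<Rightarrow> nat \<Rightarrow> ('k \<Rightarrow> nat \<Rightarrow> nat \<Rightarrow> complex) \<Rightarrow> 'k channel \<Rightarrow>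
     'k \<Rightarrow> (nat \<Rightarrow> complex) \<Rightarrow> ('k \<Rightarrow> nat) \<Rightarrow> nat" where
  "successive_decoder T S M n f h j y m = (if j \<in> S
     then LEAST w. w \<in> {1..M j} \<and>
       (\<Sum>t<n. (cmod (y t - (\<Sum>i\<in>T j - {j}. h t j i * f i (m i) t) - h t j j * f j w t))\<^sup>2) \<le> 4 * real n
     else 1)"

lemma measurable_successive_decoder:
  "(\<lambda>y. successive_decoder T S M n f h j y m) \<in> PiM {..<n} (\<lambda>_. borel) \<rightarrow>\<^sub>M count_space UNIV"
  unfolding successive_decoder_def by (cases "j \<in> S") (simp_all, measurable)

text \<open>An active interferer of an active user precedes it in \<open>prec\<close>, so its
  message has been passed and is right by induction. Cancellation leaves a single-user channel,
  where the code distance makes the threshold test unambiguous.\<close>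

lemma successive_decoder_correct:
  fixes T :: "'k::finite \<Rightarrow> 'k set"
  assumes self: "\<And>j. j \<in> T j" and h: "0 < hmin" "h \<in> channels hmin hmax T"
    and order: "decoding_order prec" "induced (conflict_digraph T) S \<subseteq> prec"
    and inactive: "\<And>i w t. i \<notin> S \<Longrightarrow> f i w t = 0" "\<And>i. i \<notin> S \<Longrightarrow> M i = 1"
    and far: "\<And>i w w'. i \<in> S \<Longrightarrow> w \<in> {1..M i} \<Longrightarrow> w' \<in> {1..M i} \<Longrightarrow> w \<noteq> w' \<Longrightarrow>
        16 / hmin\<^sup>2 * real n < (\<Sum>t<n. (cmod (f i w t - f i w' t))\<^sup>2)"
    and w: "\<forall>i. w i \<in> {1..M i}"
    and z: "\<And>j. (\<Sum>t<n. (cmod (z (j, t)))\<^sup>2) \<le> 4 * real n"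
  shows "decoded prec (successive_decoder T S M n f h) (received T h n (\<lambda>i. f i (w i)) z) j = w j"
proof -
  let ?y = "received T h n (\<lambda>i. f i (w i)) z"
  let ?m = "decoded prec (successive_decoder T S M n f h) ?y"
  have "wf prec"
    using order by (simp add: decoding_order_def acyclic_irrefl finite_acyclic_wf)
  then show ?thesis
  proof (induction j rule: wf_induct_rule)
    case (less j)
    let ?r = "restrict ?m {k. (k, j) \<in> prec}"
    show ?case
    proof (cases "j \<in> S")
      case False
      then show ?thesis
        using w inactive(2)[of j] spec[OF w, of j]
        by (subst decoded_eq[OF order(1)]) (simp add: successive_decoder_def)
    next
      case True
      have "h t j i * f i (?r i) t = h t j i * f i (w i) t" if "i \<in> T j - {j}" for i t
      proof (cases "i \<in> S")
        case i: True
        then have "(i, j) \<in> prec"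
          using that True order(2) unfolding induced_def conflict_digraph_def by auto
        then show ?thesis
          using less[of i] by simp
      qed (simp add: inactive(1))
      then have interference: "(\<Sum>i\<in>T j - {j}. h t j i * f i (?r i) t) = (\<Sum>i\<in>T j - {j}. h t j i * f i (w i) t)" for t
        by (intro sum.cong refl) blast
      have residual: "?y j t - (\<Sum>i\<in>T j - {j}. h t j i * f i (?r i) t) - h t j j * f j v t =
          h t j j * f j (w j) t + z (j, t) - h t j j * f j v t" if "t < n" for v t
        unfolding interference using that self[of j]
        by (simp add: received_def sum.remove[of "T j" j])
      have "?m j = successive_decoder T S M n f h j (?y j) ?r"
        by (rule decoded_eq[OF order(1)])
      also have "\<dots> = (LEAST v. v \<in> {1..M j} \<and>
          (\<Sum>t<n. (cmod (h t j j * f j (w j) t + z (j, t) - h t j j * f j v t))\<^sup>2) \<le> 4 * real n)"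
        using True residual unfolding successive_decoder_def by simp
      also have "\<dots> = w j"
      proof (rule Least_equality)
        show "w j \<in> {1..M j} \<and> (\<Sum>t<n. (cmod (h t j j * f j (w j) t + z (j, t) - h t j j * f j (w j) t))\<^sup>2) \<le> 4 * real n"
          using w z[of j] by simp
        fix v assume v: "v \<in> {1..M j} \<and>
          (\<Sum>t<n. (cmod (h t j j * f j (w j) t + z (j, t) - h t j j * f j v t))\<^sup>2) \<le> 4 * real n"
        have "v = w j"
        proof (rule ccontr)
          assume "v \<noteq> w j"
          then have "16 / hmin\<^sup>2 * real n < (\<Sum>t<n. (cmod (f j (w j) t - f j v t))\<^sup>2)"
            using True w v by (intro far) auto
          moreover have "hmin \<le> cmod (h t j j)" for t
            using h(2) self[of j] unfolding channels_def by auto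
          ultimately show False
            using threshold_decoding_unique[where n=n and hmin=hmin and h="\<lambda>t. h t j j"
                and x="f j (w j)" and x'="f j v" and z="\<lambda>t. z (j, t)"]
              h(1) z[of j] v by simp
        qed
        then show "w j \<le> v" by simp
      qed
      finally show ?thesis .
    qed
  qed
qed

lemma measure_noise_energy_le:
  "measure (noise n) {z \<in> space (noise n). \<exists>j :: 'k::finite. 4 * real n \<le> (\<Sum>t<n. (cmod (z (j, t)))\<^sup>2)}
     \<le> CARD('k) * (2 * exp (- 2)) ^ n"
proof -
  interpret Z: prob_space "noise n :: ('k \<times> nat \<Rightarrow> complex) measure" by (rule prob_space_noise)
  let ?N = "PiM {..<n} (\<lambda>_. complex_gaussian)"
  interpret N: prob_space ?N
    by (intro prob_space_PiM prob_space_complex_gaussian)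
  let ?B = "{y \<in> space ?N. 4 * real n \<le> (\<Sum>t<n. (cmod (y t))\<^sup>2)}"
  have B: "?B \<in> sets ?N" by measurable
  have eq: "{z \<in> space (noise n). 4 * real n \<le> (\<Sum>t<n. (cmod (z (j, t)))\<^sup>2)} =
      {z \<in> space (noise n). (\<lambda>t\<in>{..<n}. z (j, t)) \<in> ?B}" for j :: 'k
    using measurable_space[OF measurable_noise_component[of j n]] by auto
  have sets: "{z \<in> space (noise n). 4 * real n \<le> (\<Sum>t<n. (cmod (z (j, t)))\<^sup>2)} \<in> sets (noise n)" for j :: 'k
    unfolding eq using measurable_sets[OF measurable_noise_component B, of j]
    by (simp add: vimage_def Int_def conj_commute)
  have "{z \<in> space (noise n). \<exists>j :: 'k. 4 * real n \<le> (\<Sum>t<n. (cmod (z (j, t)))\<^sup>2)} =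
      (\<Union>j\<in>UNIV. {z \<in> space (noise n). 4 * real n \<le> (\<Sum>t<n. (cmod (z (j, t)))\<^sup>2)})"
    by auto
  then have "measure (noise n) {z \<in> space (noise n). \<exists>j :: 'k. 4 * real n \<le> (\<Sum>t<n. (cmod (z (j, t)))\<^sup>2)}
      \<le> (\<Sum>j\<in>(UNIV :: 'k set). measure (noise n) {z \<in> space (noise n). 4 * real n \<le> (\<Sum>t<n. (cmod (z (j, t)))\<^sup>2)})"
    using sets by (simp only:) (intro Z.finite_measure_subadditive_finite, auto)
  also have "\<dots> = CARD('k) * measure ?N ?B"
    unfolding eq measure_noise_component[OF B] by simp
  also have "\<dots> \<le> CARD('k) * (2 * exp (- 2)) ^ n"
    using emeasure_PiM_complex_gaussian_energy_le[of "{..<n}"]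
    by (intro mult_left_mono) (simp_all add: N.emeasure_eq_measure)
  finally show ?thesis .
qed

text \<open>\<open>C\<close> is the packing loss per letter for squared distance
  \<open>16 / hmin^2\<close> per symbol. The first condition on \<open>q\<close> makes the rate
  nonnegative, the second bounds the energy of every grid point by \<open>P\<close>.\<close>

lemma acyclic_round_achievable:
  fixes T :: "'k::finite \<Rightarrow> 'k set" and hmin :: real
  defines "C \<equiv> 9 * 2 powr (16 / hmin\<^sup>2)"
  assumes self: "\<And>j. j \<in> T j" and hmin: "0 < hmin"
    and order: "decoding_order prec" "induced (conflict_digraph T) S \<subseteq> prec"
    and q: "C \<le> (real q)\<^sup>2" "2 * (real q)\<^sup>2 \<le> P"
  shows "log 2 ((real q)\<^sup>2 / C) *\<^sub>R incidence_vector S \<in> rate_region_active hmin hmax T P S prec"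
proof -
  define R where "R = log 2 ((real q)\<^sup>2 / C) *\<^sub>R (incidence_vector S :: real ^ 'k)"
  have C: "0 < C"
    unfolding C_def by simp
  then have q0: "1 \<le> (real q)\<^sup>2 / C"
    using q(1) by simp
  have R_S: "R $ i = log 2 ((real q)\<^sup>2 / C)" if "i \<in> S" for i
    using that unfolding R_def incidence_vector_def by simp
  have R_out: "R $ i = 0" if "i \<notin> S" for i
    using that unfolding R_def incidence_vector_def by simp
  have R0: "0 \<le> R $ i" for i
    using q0 by (cases "i \<in> S") (auto simp: R_S R_out)
  let ?M = "\<lambda>n. num_messages n R"
  have M_out: "?M n i = 1" if "i \<notin> S" for n i
    using R_out[OF that] unfolding num_messages_def by simp
  define code where "code n i x \<longleftrightarrow> (\<forall>w\<in>{1..?M n i}. \<forall>t<n. x w t \<in> qam q) \<and>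
      (\<forall>w\<in>{1..?M n i}. \<forall>w'\<in>{1..?M n i}. w \<noteq> w' \<longrightarrow>
        16 / hmin\<^sup>2 * real n < (\<Sum>t<n. (cmod (x w t - x w' t))\<^sup>2))"
    for n i and x :: "nat \<Rightarrow> nat \<Rightarrow> complex"
  have ex_code: "\<exists>x. code n i x" if "i \<in> S" for n i
  proof -
    have "real (?M n i) \<le> 2 powr (n * log 2 ((real q)\<^sup>2 / C))"
      using num_messages_bounds(2)[OF R0, of n i] R_S[OF that] by simp
    also have "\<dots> = ((real q)\<^sup>2 / C) ^ n"
      using q0 by (simp add: mult.commute[of "real n"] powr_powr[symmetric] powr_realpow)
    finally have "real (?M n i) * C ^ n \<le> ((real q)\<^sup>2) ^ n"
      using C by (simp add: power_divide pos_le_divide_eq)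
    moreover have "0 \<le> 16 / hmin\<^sup>2"
      by simp
    ultimately obtain x :: "nat \<Rightarrow> nat \<Rightarrow> complex" where
      "\<And>w t. w \<in> {1..?M n i} \<Longrightarrow> t < n \<Longrightarrow> x w t \<in> qam q"
      "\<And>w w'. w \<in> {1..?M n i} \<Longrightarrow> w' \<in> {1..?M n i} \<Longrightarrow> w \<noteq> w' \<Longrightarrow>
        16 / hmin\<^sup>2 * real n < (\<Sum>t<n. (cmod (x w t - x w' t))\<^sup>2)"
      unfolding C_def using ex_qam_code[of "16 / hmin\<^sup>2" "?M n i" n q] by blast
    then show ?thesis
      unfolding code_def by blast
  qed
  \<comment> \<open>The encoder is one function of all block lengths and users, so the codes are
    picked simultaneously and before any channel is fixed.\<close>
  define x where "x n i = (SOME x. code n i x)" for n i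
  have code: "code n i (x n i)" if "i \<in> S" for n i
    unfolding x_def using ex_code[OF that] by (rule someI_ex)
  have x: "x n i w t \<in> qam q" if "i \<in> S" "w \<in> {1..?M n i}" "t < n" for n i w t
    using code[OF that(1), of n] that(2,3) unfolding code_def by blast
  have far: "16 / hmin\<^sup>2 * real n < (\<Sum>t<n. (cmod (x n i w t - x n i w' t))\<^sup>2)"
    if "i \<in> S" "w \<in> {1..?M n i}" "w' \<in> {1..?M n i}" "w \<noteq> w'" for n i w w'
    using code[OF that(1), of n] that(2-4) unfolding code_def by blast
  define f where "f n i w t = (if i \<in> S then x n i w t else 0)" for n i w t
  define g where "g n h = successive_decoder T S (?M n) n (f n) h" for n h
  have "power_constraint n P (?M n) (f n)" for n
    unfolding power_constraint_def
  proof
    fix i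
    have "(cmod (f n i w t))\<^sup>2 \<le> P" if "w \<in> {1..?M n i}" "t < n" for w t
      using qam_energy[OF x[OF _ that]] q(2) order_trans[OF zero_le_power2, of "real q" P]
      unfolding f_def by (smt (verit) norm_zero power_zero_numeral zero_le_power2)
    \<comment> \<open>Block length 0 is included: the quotient is then 0 by convention, and
      \<open>0 \<le> P\<close> is inherited from \<open>q\<close>.\<close>
    then have "(\<Sum>t<n. (cmod (f n i w t))\<^sup>2) / n \<le> P" if "w \<in> {1..?M n i}" for w
      using that sum_bounded_above[of "{..<n}" "\<lambda>t. (cmod (f n i w t))\<^sup>2" P] q(2)
        order_trans[OF _ q(2), of 0]
      by (cases "n = 0") (auto simp: divide_le_eq mult.commute)
    then have "(\<Sum>w\<in>{1..?M n i}. (\<Sum>t<n. (cmod (f n i w t))\<^sup>2) / n) \<le> ?M n i * P"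
      using sum_bounded_above[of "{1..?M n i}" "\<lambda>w. (\<Sum>t<n. (cmod (f n i w t))\<^sup>2) / n" P] by simp
    moreover have "0 < ?M n i"
      using num_messages_bounds(1)[OF R0, of n i] by simp
    ultimately show "(\<Sum>w\<in>{1..?M n i}. (\<Sum>t<n. (cmod (f n i w t))\<^sup>2) / n) / ?M n i \<le> P"
      by (simp add: divide_le_eq mult.commute)
  qed
  moreover have g_meas: "(\<lambda>y. g n h j y m) \<in> PiM {..<n} (\<lambda>_. borel) \<rightarrow>\<^sub>M count_space UNIV" for n h j m
    unfolding g_def by (rule measurable_successive_decoder)
  moreover have "(\<lambda>n. MAX j. error_prob T h prec n (?M n) (f n) (g n h) j) \<longlonglongrightarrow> 0"
    if h: "h \<in> channels hmin hmax T" for h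
  proof -
    have "error_prob T h prec n (?M n) (f n) (g n h) j \<le> CARD('k) * (2 * exp (- 2)) ^ n" for n j
    proof -
      interpret Z: prob_space "noise n :: ('k \<times> nat \<Rightarrow> complex) measure" by (rule prob_space_noise)
      let ?W = "{w. \<forall>i. w i \<in> {1..?M n i}}"
      let ?bad = "{z \<in> space (noise n). \<exists>j :: 'k. 4 * real n \<le> (\<Sum>t<n. (cmod (z (j, t)))\<^sup>2)}"
      have bad: "?bad \<in> sets (noise n)"
        unfolding noise_def by measurable
      have "measure (noise n) {z \<in> space (noise n). decoded prec (g n h) (received T h n (\<lambda>i. f n i (w i)) z) j \<noteq> w j}
          \<le> CARD('k) * (2 * exp (- 2)) ^ n" if w: "w \<in> ?W" for w
      proof -
        \<comment> \<open>The exceptional noise event depends on neither the messages nor the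
          channel, so averaging over messages keeps the bound.\<close>
        have "{z \<in> space (noise n). decoded prec (g n h) (received T h n (\<lambda>i. f n i (w i)) z) j \<noteq> w j} \<subseteq> ?bad"
        proof safe
          fix z assume "decoded prec (g n h) (received T h n (\<lambda>i. f n i (w i)) z) j \<noteq> w j"
          then show "\<exists>j. 4 * real n \<le> (\<Sum>t<n. (cmod (z (j, t)))\<^sup>2)"
            using successive_decoder_correct[OF self hmin h order, of "f n" "?M n" n w z j] M_out far w
            unfolding f_def g_def by (fastforce simp: not_le less_imp_le)
        qed
        then have "measure (noise n) {z \<in> space (noise n). decoded prec (g n h) (received T h n (\<lambda>i. f n i (w i)) z) j \<noteq> w j}
            \<le> measure (noise n) ?bad"
          using bad by (rule Z.finite_measure_mono)
        also note measure_noise_energy_le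
        finally show ?thesis .
      qed
      then have "(\<Sum>w\<in>?W. measure (noise n) {z \<in> space (noise n). decoded prec (g n h) (received T h n (\<lambda>i. f n i (w i)) z) j \<noteq> w j})
          \<le> card ?W * (CARD('k) * (2 * exp (- 2)) ^ n)"
        by (rule sum_bounded_above)
      moreover have "0 < card ?W"
        unfolding card_message_set using num_messages_bounds(1)[OF R0, of n]
        by (intro prod_pos) (simp add: Suc_le_eq)
      ultimately show ?thesis
        unfolding error_prob_eq_average[OF order(1) num_messages_bounds(1)[OF R0] g_meas]
        by (simp add: divide_le_eq mult.commute)
    qed
    then have upper: "(MAX j. error_prob T h prec n (?M n) (f n) (g n h) j) \<le> CARD('k) * (2 * exp (- 2)) ^ n" for n
      by (intro Max.boundedI) auto
    have lower: "0 \<le> (MAX j. error_prob T h prec n (?M n) (f n) (g n h) j)" for n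
      by (rule order_trans[OF _ Max_ge[OF _ rangeI[of _ undefined]]]) (auto simp: error_prob_def)
    have lim: "(\<lambda>n. CARD('k) * (2 * exp (- 2)) ^ n :: real) \<longlonglongrightarrow> real CARD('k) * 0"
    proof (intro tendsto_mult tendsto_const LIMSEQ_power_zero)
      have "2 < exp (2 :: real)"
        using exp_ge_add_one_self[of 2] by simp
      then show "norm (2 * exp (- 2) :: real) < 1"
        by (simp add: exp_minus field_simps)
    qed
    show ?thesis
      by (rule real_tendsto_sandwich[OF always_eventually always_eventually tendsto_const lim[simplified mult_zero_right]])
        (intro allI lower upper)+
  qed
  ultimately show ?thesis
    using R0 unfolding rate_region_active_def R_def[symmetric] mem_Collect_eq
    by (intro conjI allI exI[of _ f] exI[of _ g] ballI) (auto simp: f_def)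
qed

section \<open>The DoF region\<close>

lemma rate_region_active_mono:
  assumes "S \<subseteq> S'"
  shows "rate_region_active hmin hmax T P S prec \<subseteq> rate_region_active hmin hmax T P S' prec"
  unfolding rate_region_active_def
  by (intro Collect_mono impI, elim conjE exE, intro conjI exI, assumption, assumption)
    (use assms in blast, assumption+)

lemma orthogonal_access_region_subset:
  "orthogonal_access_region hmin hmax T P \<subseteq> capacity_region hmin hmax T P"
  unfolding orthogonal_access_region_def capacity_region_def rate_region_def
proof (rule hull_mono, rule subsetI)
  fix R
  assume "R \<in> (\<Union>(S, prec) \<in> {(S, prec). acyclic_set (conflict_digraph T) S \<and>
      decoding_order prec \<and> induced (conflict_digraph T) S \<subseteq> prec}.
      rate_region_active hmin hmax T P S prec)"
  then obtain S prec where "decoding_order prec" "R \<in> rate_region_active hmin hmax T P S prec"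
    by auto
  then have "R \<in> rate_region_active hmin hmax T P UNIV prec"
    using rate_region_active_mono[OF subset_UNIV, of hmin hmax T P S prec] by auto
  with \<open>decoding_order prec\<close>
  show "R \<in> (\<Union>prec \<in> {prec. decoding_order prec}. rate_region_active hmin hmax T P UNIV prec)"
    by auto
qed

lemma dof_tuples_mono:
  assumes "\<And>P. C P \<subseteq> C' P"
  shows "dof_tuples C \<subseteq> dof_tuples C'"
  using assms unfolding dof_tuples_def by blast

lemma acyclic_set_decoding_order:
  assumes "acyclic_set A S"
  obtains prec where "decoding_order prec" "induced A S \<subseteq> prec"
proof (rule that)
  show "decoding_order ((induced A S)\<^sup>+)"
    using assms unfolding decoding_order_def acyclic_set_def by (simp add: acyclic_irrefl)
qed auto

text \<open>At a given power all acyclic sets get the same rate per active user, so time sharing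
  scales their whole hull by one number. At power \<open>2 * q^2\<close> this number is
  \<open>log P - log (2 * C)\<close>, and its ratio to \<open>log P\<close> tends to 1.\<close>

lemma convex_hull_acyclic_sets_subset_dof:
  fixes T :: "'k::finite \<Rightarrow> 'k set"
  assumes self: "\<And>j. j \<in> T j" and "0 < hmin"
  shows "convex hull (incidence_vector ` {S. acyclic_set (conflict_digraph T) S})
           \<subseteq> orthogonal_access_dof_region hmin hmax T"
proof
  fix d :: "real ^ 'k"
  assume d: "d \<in> convex hull (incidence_vector ` {S. acyclic_set (conflict_digraph T) S})"
  define C where "C = 9 * 2 powr (16 / hmin\<^sup>2)"
  have C: "1 \<le> C"
    unfolding C_def using ge_one_powr_ge_zero[of 2 "16 / hmin\<^sup>2"] by simp
  \<comment> \<open>An offset that makes the grid large enough from the first term on; since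
    \<open>1 \<le> C\<close>, squaring keeps the bound.\<close>
  obtain q0 :: nat where "C \<le> q0"
    using real_arch_simple by blast
  then have q0: "C \<le> real (m + q0)" for m
    by (simp add: add_increasing)
  have q: "C \<le> (real (m + q0))\<^sup>2" for m
    using q0[of m] C self_le_power[of "real (m + q0)" 2] by linarith
  \<comment> \<open>A DoF tuple needs one sequence of powers only, so it is chosen to fit the grids
    exactly and no rounding of \<open>sqrt (P / 2)\<close> arises.\<close>
  define P where "P m = 2 * (real (m + q0))\<^sup>2" for m
  define R where "R m = log 2 ((real (m + q0))\<^sup>2 / C) *\<^sub>R d" for m
  have "R m \<in> orthogonal_access_region hmin hmax T (P m)" for m
  proof -
    let ?U = "\<Union>(S, prec) \<in> {(S, prec). acyclic_set (conflict_digraph T) S \<and>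
        decoding_order prec \<and> induced (conflict_digraph T) S \<subseteq> prec}.
        rate_region_active hmin hmax T (P m) S prec"
    let ?\<rho> = "log 2 ((real (m + q0))\<^sup>2 / C)"
    have "(*\<^sub>R) ?\<rho> ` incidence_vector ` {S. acyclic_set (conflict_digraph T) S} \<subseteq> ?U"
    proof safe
      fix S assume S: "acyclic_set (conflict_digraph T) S"
      then obtain prec where prec: "decoding_order prec" "induced (conflict_digraph T) S \<subseteq> prec"
        by (rule acyclic_set_decoding_order)
      have "?\<rho> *\<^sub>R incidence_vector S \<in> rate_region_active hmin hmax T (P m) S prec"
        unfolding C_def
        by (rule acyclic_round_achievable[OF self assms(2) prec]) (use q in \<open>simp_all add: C_def P_def\<close>)
      then show "?\<rho> *\<^sub>R incidence_vector S \<in> ?U"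
        using S prec by blast
    qed
    then have "convex hull ((*\<^sub>R) ?\<rho> ` incidence_vector ` {S. acyclic_set (conflict_digraph T) S})
        \<subseteq> convex hull ?U"
      by (rule hull_mono)
    then show ?thesis
      using d unfolding convex_hull_scaling R_def orthogonal_access_region_def by blast
  qed
  moreover have P: "filterlim P at_top sequentially"
  proof (rule filterlim_at_top_mono)
    show "filterlim real at_top sequentially"
      by (rule filterlim_real_sequentially)
    have "real m \<le> P m" for m
      unfolding P_def using self_le_power[of "real (m + q0)" 2] C q0[of m] by simp
    then show "\<forall>\<^sub>F m in sequentially. real m \<le> P m"
      by simp
  qed
  moreover have "(\<lambda>m. R m $ i / log 2 (P m)) \<longlonglongrightarrow> d $ i" for i
  proof -
    have "(\<lambda>m. (1 - log 2 (2 * C) / log 2 (P m)) * d $ i) \<longlonglongrightarrow> (1 - 0) * d $ i"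
      using filterlim_log2_at_top[OF P]
      by (intro tendsto_mult tendsto_diff tendsto_const tendsto_divide_0[OF tendsto_const]
          filterlim_at_top_imp_at_infinity)
    moreover have "R m $ i / log 2 (P m) = (1 - log 2 (2 * C) / log 2 (P m)) * d $ i" for m
    proof -
      have "1 \<le> (real (m + q0))\<^sup>2"
        using q[of m] C by linarith
      then have "1 < P m"
        unfolding P_def by linarith
      then have "0 < log 2 (P m)" and "0 < P m"
        by simp_all
      moreover have "(real (m + q0))\<^sup>2 / C = P m / (2 * C)"
        unfolding P_def by simp
      then have "log 2 ((real (m + q0))\<^sup>2 / C) = log 2 (P m) - log 2 (2 * C)"
        using C \<open>0 < P m\<close> by (simp only: log_divide) simp
      then have "R m $ i = (log 2 (P m) - log 2 (2 * C)) * d $ i"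
        unfolding R_def vector_scaleR_component real_scaleR_def by (rule arg_cong)
      moreover have "(l - c) * x / l = (1 - c / l) * x" if "0 < l" for l c x :: real
        using that by (simp add: field_simps)
      ultimately show ?thesis
        by simp
    qed
    ultimately show ?thesis by simp
  qed
  ultimately show "d \<in> orthogonal_access_dof_region hmin hmax T"
    unfolding orthogonal_access_dof_region_def dof_tuples_def by blast
qed

theorem theorem3:
  fixes T :: "'k::finite \<Rightarrow> 'k set" and hmin hmax :: real
  assumes "\<And>j. j \<in> T j"
    and "0 < hmin" and "hmin \<le> hmax"
    and "\<And>n S. 3 \<le> n \<Longrightarrow> \<not> is_dicycle (conflict_digraph T) n S"
    and "perfect_matrix (maximal_sets (digraph_clique (conflict_digraph T))) incidence_vector"
  shows "dof_region hmin hmax T = set_packing_polytope (symmetric_part (conflict_digraph T)) \<and>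
         orthogonal_access_dof_region hmin hmax T = dof_region hmin hmax T"
proof -
  let ?A = "conflict_digraph T"
  \<comment> \<open>The inclusions form a cycle through the hull of the acyclic sets, orthogonal
    access and the full DoF region, which yields both equalities at once.\<close>
  have "set_packing_polytope (symmetric_part ?A) \<subseteq> convex hull (incidence_vector ` {S. acyclic_set ?A S})"
    using assms(4,5) by (intro set_packing_polytope_subset_hull) (auto simp: conflict_digraph_def)
  also have "\<dots> \<subseteq> orthogonal_access_dof_region hmin hmax T"
    using assms(1,2) by (rule convex_hull_acyclic_sets_subset_dof)
  finally have inner: "set_packing_polytope (symmetric_part ?A) \<subseteq> orthogonal_access_dof_region hmin hmax T" .
  have "orthogonal_access_dof_region hmin hmax T \<subseteq> dof_region hmin hmax T"
    unfolding orthogonal_access_dof_region_def dof_region_def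
    by (intro dof_tuples_mono orthogonal_access_region_subset)
  moreover have "dof_region hmin hmax T \<subseteq> set_packing_polytope (symmetric_part ?A)"
    using assms(1-3) by (rule dof_region_subset)
  ultimately show ?thesis
    using inner by blast
qed

end
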